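(* Let $m\ge n\ge 2$. Then $C(S^1)^{(n)}$ is an operator system quotient of $C(S^1)^{(m)}$; that is, there is a complete quotient map $C(S^1)^{(m)}\to C(S^1)^{(n)}$.
   Context: $C(S^1)^{(n)}$ is the operator system of all $n\times n$ complex Toeplitz matrices, an operator subsystem of $\mathcal M_n(\mathbb C)$. If $\phi:\mathcal R\to\mathcal T$ is a completely positive linear map of operator systems and $\mathcal J=\ker\phi$, the quotient vector space $\mathcal R/\mathcal J$ is an operator system with order unit the coset of $e_{\mathcal R}$, in which (identifying $\mathcal M_p(\mathcal R/\mathcal J)$ with $\mathcal M_p(\mathcal R)/\mathcal M_p(\mathcal J)$) the cone $\mathcal M_p(\mathcal R/\mathcal J)_+$ is the set of cosets $\dot h$ of selfadjoint $h\in\mathcal M_p(\mathcal R)$ such that for each $\varepsilon>0$ there is a selfadjoint $k_\varepsilon\in\mathcal M_p(\mathcal J)$ with $\varepsilon\,(e_{\mathcal R}\otimes 1_p)+h+k_\varepsilon\in\mathcal M_p(\mathcal R)_+$. There is an induced completely positive map $\dot\phi:\mathcal R/\mathcal J\to\mathcal T$ with $\phi=\dot\phi\circ\pi_{\mathcal J}$, where $\pi_{\mathcal J}$ is the canonical projection; $\phi$ is a complete quotient map if $\dot\phi$ is a complete order isomorphism (a linear bijection, completely positive with completely positive inverse). $\mathcal T$ is an operator system quotient of $\mathcal R$ if there is a (unital) complete quotient map $\mathcal R\to\mathcal T$. *)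

theory Defs
  imports "Jordan_Normal_Form.Schur_Decomposition" "Jordan_Normal_Form.VS_Connect"
    "HOL-Algebra.AbelCoset"
begin

text \<open>
  Abstract (Choi--Effros) operator systems. The space \<open>V\<close> is a complex module record in the sense
  of HOL-Algebra (its fields \<open>mult\<close> and \<open>one\<close> carry no meaning), \<open>star\<close> is the involution,
  \<open>ounit\<close> the order unit and \<open>cone V p\<close> the positive cone of the \<open>p \<times> p\<close> matrices over \<open>V\<close>.
\<close>

record 'a opsys = "(complex, 'a) module" +
  star :: "'a \<Rightarrow> 'a"
  ounit :: 'a
  cone :: "nat \<Rightarrow> 'a mat set"

definition mats :: "'a set \<Rightarrow> nat \<Rightarrow> 'a mat set" where
  "mats S p = {A \<in> carrier_mat p p. \<forall>i<p. \<forall>j<p. A $$ (i, j) \<in> S}"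

definition mat_star :: "'a opsys \<Rightarrow> 'a mat \<Rightarrow> 'a mat" where
  "mat_star V A = mat (dim_col A) (dim_row A) (\<lambda>(i, j). star V (A $$ (j, i)))"

definition sa_mats :: "'a opsys \<Rightarrow> 'a set \<Rightarrow> nat \<Rightarrow> 'a mat set" where
  "sa_mats V S p = {A \<in> mats S p. mat_star V A = A}"

definition mat_add :: "'a opsys \<Rightarrow> 'a mat \<Rightarrow> 'a mat \<Rightarrow> 'a mat" where
  "mat_add V A B = mat (dim_row A) (dim_col A) (\<lambda>ij. A $$ ij \<oplus>\<^bsub>V\<^esub> B $$ ij)"

text \<open>\<open>scaled_unit V r p\<close> is \<open>r (e \<otimes> 1\<^sub>p)\<close>, and \<open>compress V X A\<close> is \<open>X A X\<^sup>*\<close> for a scalar matrix \<open>X\<close>.\<close>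

definition scaled_unit :: "'a opsys \<Rightarrow> real \<Rightarrow> nat \<Rightarrow> 'a mat" where
  "scaled_unit V r p =
    mat p p (\<lambda>(i, j). if i = j then complex_of_real r \<odot>\<^bsub>V\<^esub> ounit V else \<zero>\<^bsub>V\<^esub>)"

definition compress :: "'a opsys \<Rightarrow> complex mat \<Rightarrow> 'a mat \<Rightarrow> 'a mat" where
  "compress V X A = mat (dim_row X) (dim_row X) (\<lambda>(i, j).
     \<Oplus>\<^bsub>V\<^esub>k\<in>{..<dim_col X}. \<Oplus>\<^bsub>V\<^esub>l\<in>{..<dim_col X}.
       (X $$ (i, k) * cnj (X $$ (j, l))) \<odot>\<^bsub>V\<^esub> A $$ (k, l))"

locale operator_system = vectorspace "class_ring :: complex ring" V for V :: "'a opsys" +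
  assumes star_closed: "x \<in> carrier V \<Longrightarrow> star V x \<in> carrier V"
    and star_star: "x \<in> carrier V \<Longrightarrow> star V (star V x) = x"
    and star_add: "\<lbrakk>x \<in> carrier V; y \<in> carrier V\<rbrakk> \<Longrightarrow>
      star V (x \<oplus>\<^bsub>V\<^esub> y) = star V x \<oplus>\<^bsub>V\<^esub> star V y"
    and star_smult: "x \<in> carrier V \<Longrightarrow> star V (c \<odot>\<^bsub>V\<^esub> x) = cnj c \<odot>\<^bsub>V\<^esub> star V x"
    and unit_closed: "ounit V \<in> carrier V"
    and star_unit: "star V (ounit V) = ounit V"
    and cone_selfadjoint: "0 < p \<Longrightarrow> cone V p \<subseteq> sa_mats V (carrier V) p"
    and cone_add: "\<lbrakk>0 < p; A \<in> cone V p; B \<in> cone V p\<rbrakk> \<Longrightarrow> mat_add V A B \<in> cone V p"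
    and cone_compress: "\<lbrakk>0 < p; 0 < q; A \<in> cone V p; X \<in> carrier_mat q p\<rbrakk> \<Longrightarrow>
      compress V X A \<in> cone V q"
    and cone_proper: "\<lbrakk>0 < p; A \<in> cone V p; map_mat (\<lambda>x. \<ominus>\<^bsub>V\<^esub> x) A \<in> cone V p\<rbrakk> \<Longrightarrow>
      A = mat p p (\<lambda>_. \<zero>\<^bsub>V\<^esub>)"
    and order_unit: "\<lbrakk>0 < p; A \<in> sa_mats V (carrier V) p\<rbrakk> \<Longrightarrow>
      \<exists>r>0. mat_add V (scaled_unit V r p) A \<in> cone V p"
    and archimedean: "\<lbrakk>0 < p; A \<in> sa_mats V (carrier V) p;
      \<And>\<epsilon>. 0 < \<epsilon> \<Longrightarrow> mat_add V (scaled_unit V \<epsilon> p) A \<in> cone V p\<rbrakk> \<Longrightarrow> A \<in> cone V p"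

definition cp_map :: "'a opsys \<Rightarrow> 'b opsys \<Rightarrow> ('a \<Rightarrow> 'b) \<Rightarrow> bool" where
  "cp_map R T \<phi> \<longleftrightarrow> \<phi> \<in> LinearCombinations.module_hom class_ring R T \<and>
     (\<forall>p>0. \<forall>A\<in>cone R p. map_mat \<phi> A \<in> cone T p)"

definition complete_order_iso :: "'a opsys \<Rightarrow> 'b opsys \<Rightarrow> ('a \<Rightarrow> 'b) \<Rightarrow> bool" where
  "complete_order_iso R T \<phi> \<longleftrightarrow> bij_betw \<phi> (carrier R) (carrier T) \<and>
     cp_map R T \<phi> \<and> cp_map T R (inv_into (carrier R) \<phi>)"

text \<open>
  The quotient by a kernel \<open>J\<close>. A matrix of cosets is identified with the coset of a matrix, so
  that \<open>map_mat (\<lambda>x. J +> x) h\<close> is the class of \<open>h\<close>. For \<open>J\<close> a subspace closed under \<open>star\<close>, the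
  scalar multiple of the coset of \<open>x\<close> is the coset of \<open>c \<odot> x\<close> (the union is over representatives
  and also covers \<open>c = 0\<close>), and its adjoint is the coset of \<open>star x\<close>.
\<close>

definition opsys_quotient :: "'a opsys \<Rightarrow> 'a set \<Rightarrow> 'a set opsys" where
  "opsys_quotient R J =
    \<lparr>carrier = a_rcosets\<^bsub>R\<^esub> J,
     monoid.mult = undefined,
     one = undefined,
     zero = J,
     add = (\<lambda>X Y. X <+>\<^bsub>R\<^esub> Y),
     module.smult = (\<lambda>c X. \<Union>x\<in>X. J +>\<^bsub>R\<^esub> (c \<odot>\<^bsub>R\<^esub> x)),
     star = (\<lambda>X. star R ` X),
     ounit = J +>\<^bsub>R\<^esub> ounit R,
     cone = (\<lambda>p. {map_mat (\<lambda>x. J +>\<^bsub>R\<^esub> x) h | h. h \<in> sa_mats R (carrier R) p \<and>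
       (\<forall>\<epsilon>>0. \<exists>k\<in>sa_mats R J p.
          mat_add R (mat_add R (scaled_unit R \<epsilon> p) h) k \<in> cone R p)})\<rparr>"

text \<open>In \<open>complete_quotient_map\<close>, the map \<open>X \<mapsto> the_elem (\<phi> ` X)\<close> is the induced map on cosets.\<close>

definition complete_quotient_map :: "'a opsys \<Rightarrow> 'b opsys \<Rightarrow> ('a \<Rightarrow> 'b) \<Rightarrow> bool" where
  "complete_quotient_map R T \<phi> \<longleftrightarrow>
     operator_system R \<and> operator_system T \<and> cp_map R T \<phi> \<and>
     complete_order_iso (opsys_quotient R (a_kernel R T \<phi>)) T (\<lambda>X. the_elem (\<phi> ` X))"

definition is_operator_system_quotient_of :: "'b opsys \<Rightarrow> 'a opsys \<Rightarrow> bool" where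
  "is_operator_system_quotient_of T R \<longleftrightarrow>
     (\<exists>\<phi>. complete_quotient_map R T \<phi> \<and> \<phi> (ounit R) = ounit T)"

text \<open>
  The operator system of all complex \<open>n \<times> n\<close> matrices: \<open>block_mat n A\<close> identifies a \<open>p \<times> p\<close> matrix
  \<open>A\<close> of \<open>n \<times> n\<close> matrices with a \<open>pn \<times> pn\<close> complex matrix.
\<close>

definition psd :: "complex mat \<Rightarrow> bool" where
  "psd A \<longleftrightarrow> mat_adjoint A = A \<and> (\<forall>v\<in>carrier_vec (dim_row A). 0 \<le> (A *\<^sub>v v) \<bullet>c v)"

definition block_mat :: "nat \<Rightarrow> complex mat mat \<Rightarrow> complex mat" where
  "block_mat n A = mat (dim_row A * n) (dim_col A * n)
     (\<lambda>(i, j). A $$ (i div n, j div n) $$ (i mod n, j mod n))"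

definition matrix_opsys :: "nat \<Rightarrow> complex mat opsys" where
  "matrix_opsys n = module.extend (module_mat TYPE(complex) n n)
    \<lparr>star = mat_adjoint,
     ounit = 1\<^sub>m n,
     cone = (\<lambda>p. {A \<in> mats (carrier_mat n n) p. psd (block_mat n A)})\<rparr>"

definition subsystem :: "'a opsys \<Rightarrow> 'a set \<Rightarrow> 'a opsys" where
  "subsystem V W = V\<lparr>carrier := W, cone := (\<lambda>p. cone V p \<inter> mats W p)\<rparr>"

definition toeplitz_mats :: "nat \<Rightarrow> complex mat set" where
  "toeplitz_mats n = {mat n n (\<lambda>(i, j). \<tau> (int i - int j)) | \<tau> :: int \<Rightarrow> complex. True}"

definition toeplitz_opsys :: "nat \<Rightarrow> complex mat opsys" where
  "toeplitz_opsys n = subsystem (matrix_opsys n) (toeplitz_mats n)"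

end

theory Submission
  imports Defs
begin

text \<open>
  The quotient map is truncation to the upper left \<open>n \<times> n\<close> corner. That its inverse on cosets is
  completely positive means that every positive block Toeplitz matrix extends to a larger one. It
  suffices to enlarge \<open>N\<close> to \<open>N + 1\<close>: only the two extreme corner blocks are missing, and
  both principal sections omitting the first or the last block row and column are known and equal
  by Toeplitz invariance, hence positive. A positive completion exists, because
  one may prescribe the missing Gram entries through the orthogonal projection onto the common
  middle part. The projection also exists for degenerate forms, so cones are lifted exactly and
  the \<open>\<epsilon>\<close> in the definition of the quotient cone is only needed for the
  forward direction, where it is absorbed by the Archimedean property.
\<close>

section \<open>Positive semidefinite kernels\<close>

text \<open>Going from \<open>n\<close> to \<open>m\<close> at once would leave several diagonals
  unknown, and a completion of the missing Gram entries would have to be constant along each of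
  them. With a single additional block row and column every new diagonal consists of one block, so
  no such constraint arises; this is why the extension proceeds by induction on the size. The usual
  completion formula inverts the middle section, which may be singular here. Its substitute is the
  fact that a null vector of a positive form is orthogonal to everything, which lets Gram-Schmidt
  pass over degenerate directions. Kernels on arbitrary index sets replace matrices because
  principal sections then become subsets, the shift becomes a reindexing, and the splitting of a
  vector needs no block partitions.\<close>

definition sesq :: "'i set \<Rightarrow> ('i \<Rightarrow> 'i \<Rightarrow> complex) \<Rightarrow> ('i \<Rightarrow> complex) \<Rightarrow> ('i \<Rightarrow> complex) \<Rightarrow> complex" where
  "sesq S K f g = (\<Sum>x\<in>S. \<Sum>y\<in>S. cnj (f x) * K x y * g y)"

text \<open>In the order on \<open>complex\<close>, \<open>0 \<le> z\<close> also says that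
  \<open>z\<close> is real. The vectors \<open>f\<close> are total functions, whose values outside
  \<open>S\<close> do not enter the form.\<close>

definition psd_on :: "'i set \<Rightarrow> ('i \<Rightarrow> 'i \<Rightarrow> complex) \<Rightarrow> bool" where
  "psd_on S K \<longleftrightarrow> (\<forall>x\<in>S. \<forall>y\<in>S. cnj (K x y) = K y x) \<and> (\<forall>f. 0 \<le> sesq S K f f)"

lemma sesq_left: "sesq S K f g = (\<Sum>x\<in>S. cnj (f x) * (\<Sum>y\<in>S. K x y * g y))"
  by (simp add: sesq_def sum_distrib_left mult.assoc)

lemma sesq_right: "sesq S K f g = (\<Sum>y\<in>S. (\<Sum>x\<in>S. cnj (f x) * K x y) * g y)"
  unfolding sesq_def by (subst sum.swap) (simp add: sum_distrib_right)

lemma sesq_add_left: "sesq S K (\<lambda>x. f x + f' x) g = sesq S K f g + sesq S K f' g"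
  by (simp add: sesq_def sum.distrib algebra_simps)

lemma sesq_add_right: "sesq S K f (\<lambda>x. g x + g' x) = sesq S K f g + sesq S K f g'"
  by (simp add: sesq_def sum.distrib algebra_simps)

lemma sesq_scale_left: "sesq S K (\<lambda>x. c * f x) g = cnj c * sesq S K f g"
  by (simp add: sesq_def sum_distrib_left algebra_simps)

lemma sesq_scale_right: "sesq S K f (\<lambda>x. c * g x) = c * sesq S K f g"
  by (simp add: sesq_def sum_distrib_left algebra_simps)

lemma sesq_cong:
  assumes "\<And>x y. x \<in> S \<Longrightarrow> y \<in> S \<Longrightarrow> K x y = K' x y"
    and "\<And>x. x \<in> S \<Longrightarrow> f x = f' x" and "\<And>x. x \<in> S \<Longrightarrow> g x = g' x"
  shows "sesq S K f g = sesq S K' f' g'"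
  unfolding sesq_def by (intro sum.cong refl) (simp add: assms)

lemma sesq_cnj:
  assumes "\<And>x y. x \<in> S \<Longrightarrow> y \<in> S \<Longrightarrow> cnj (K x y) = K y x"
  shows "sesq S K g f = cnj (sesq S K f g)"
proof -
  have "sesq S K g f = (\<Sum>y\<in>S. \<Sum>x\<in>S. cnj (g y) * K y x * f x)"
    by (simp add: sesq_def)
  also have "\<dots> = (\<Sum>x\<in>S. \<Sum>y\<in>S. cnj (g y) * K y x * f x)"
    by (rule sum.swap)
  also have "\<dots> = (\<Sum>x\<in>S. \<Sum>y\<in>S. cnj (cnj (f x) * K x y * g y))"
  proof (intro sum.cong refl)
    fix x y assume "x \<in> S" "y \<in> S"
    from assms[OF this] show "cnj (g y) * K y x * f x = cnj (cnj (f x) * K x y * g y)"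
      by (simp add: mult_ac)
  qed
  finally show ?thesis by (simp add: sesq_def)
qed

lemma sesq_mono_neutral:
  assumes "finite S" "T \<subseteq> S" "\<And>x. x \<in> S - T \<Longrightarrow> f x = 0" "\<And>x. x \<in> S - T \<Longrightarrow> g x = 0"
  shows "sesq S K f g = sesq T K f g"
proof -
  have "(\<Sum>y\<in>S. K x y * g y) = (\<Sum>y\<in>T. K x y * g y)" for x
    by (rule sum.mono_neutral_right) (use assms in auto)
  then show ?thesis
    unfolding sesq_left by simp (rule sum.mono_neutral_right, use assms in auto)
qed

lemma sesq_reindex:
  assumes "inj_on h S"
  shows "sesq (h ` S) K f g = sesq S (\<lambda>x y. K (h x) (h y)) (f \<circ> h) (g \<circ> h)"
  by (simp add: sesq_def sum.reindex[OF assms])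

lemma psd_on_hermitian: "psd_on S K \<Longrightarrow> x \<in> S \<Longrightarrow> y \<in> S \<Longrightarrow> cnj (K x y) = K y x"
  by (simp add: psd_on_def)

lemma psd_on_nonneg: "psd_on S K \<Longrightarrow> 0 \<le> sesq S K f f"
  by (simp add: psd_on_def)

lemma psd_on_cong:
  assumes "\<And>x y. x \<in> S \<Longrightarrow> y \<in> S \<Longrightarrow> K x y = K' x y"
  shows "psd_on S K \<longleftrightarrow> psd_on S K'"
  unfolding psd_on_def using assms sesq_cong[of S K K'] by (auto cong: ball_cong)

lemma psd_on_subset:
  assumes "psd_on S K" "finite S" "T \<subseteq> S"
  shows "psd_on T K"
  unfolding psd_on_def
proof (intro conjI allI ballI)
  fix f :: "'a \<Rightarrow> complex"
  let ?f = "\<lambda>x. if x \<in> T then f x else 0"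
  have "sesq S K ?f ?f = sesq T K ?f ?f"
    by (rule sesq_mono_neutral) (use assms in auto)
  also have "\<dots> = sesq T K f f" by (rule sesq_cong) auto
  finally show "0 \<le> sesq T K f f" using psd_on_nonneg[OF assms(1), of ?f] by (simp only:)
next
  fix x y assume "x \<in> T" "y \<in> T"
  then show "cnj (K x y) = K y x"
    by (intro psd_on_hermitian[OF assms(1)] subsetD[OF assms(3)])
qed

text \<open>Serves two purposes: the shift of positions in a Toeplitz kernel, and the passage from
  the flattened indices of \<open>block_mat\<close> to pairs of indices.\<close>

lemma psd_on_reindex:
  assumes "inj_on h S"
  shows "psd_on (h ` S) K \<longleftrightarrow> psd_on S (\<lambda>x y. K (h x) (h y))"
proof -
  have 1: "sesq S (\<lambda>x y. K (h x) (h y)) f f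
      = sesq (h ` S) K (f \<circ> inv_into S h) (f \<circ> inv_into S h)" for f
    unfolding sesq_reindex[OF assms] by (rule sesq_cong) (simp_all add: assms)
  have "(\<forall>f. 0 \<le> sesq (h ` S) K f f) \<longleftrightarrow> (\<forall>f. 0 \<le> sesq S (\<lambda>x y. K (h x) (h y)) f f)"
  proof (intro iffI allI)
    fix f :: "'a \<Rightarrow> complex"
    assume "\<forall>f. 0 \<le> sesq (h ` S) K f f"
    then show "0 \<le> sesq S (\<lambda>x y. K (h x) (h y)) f f" by (simp only: 1)
  next
    fix f :: "'b \<Rightarrow> complex"
    assume "\<forall>f. 0 \<le> sesq S (\<lambda>x y. K (h x) (h y)) f f"
    then show "0 \<le> sesq (h ` S) K f f" by (simp only: sesq_reindex[OF assms])
  qed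
  then show ?thesis
    unfolding psd_on_def by simp
qed

text \<open>A null vector lies in the radical. If the pairing \<open>v\<close> with the unit vector
  at \<open>x\<close> were nonzero, moving from \<open>f\<close> a little way against
  \<open>v\<close> in that direction would make the form negative: the change is linear in the step
  with negative slope, up to a quadratic term.\<close>

lemma psd_on_null:
  assumes S: "finite S" "psd_on S K" and null: "sesq S K f f = 0" and x: "x \<in> S"
  shows "(\<Sum>y\<in>S. K x y * f y) = 0"
proof (rule ccontr)
  define v where "v = (\<Sum>y\<in>S. K x y * f y)"
  assume "(\<Sum>y\<in>S. K x y * f y) \<noteq> 0"
  then have v: "cmod v > 0" by (simp add: v_def)
  \<comment> \<open>The form at \<open>f + c g\<close> equals \<open>s |v|^2 (s K x x - 2)\<close>,
    so any positive \<open>s\<close> with \<open>s K x x < 2\<close> gives the contradiction; this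
    choice keeps the product at most 1.\<close>
  define s :: real where "s = 1 / (1 + \<bar>Re (K x x)\<bar>)"
  define g where "g = (\<lambda>z. if z = x then v else 0)"
  define c where "c = complex_of_real (- s)"
  have gK: "sesq S K g h = cnj v * (\<Sum>y\<in>S. K x y * h y)" for h
    unfolding sesq_left g_def using S(1) x by (simp add: if_distrib[of cnj] if_distrib[of "\<lambda>c. c * t" for t] cong: if_cong)
  have vv: "cnj v * v = of_real ((cmod v)\<^sup>2)"
    by (simp only: complex_norm_square mult.commute)
  have gf: "sesq S K g f = of_real ((cmod v)\<^sup>2)"
    using gK[of f] vv by (simp only: v_def)
  have fg: "sesq S K f g = of_real ((cmod v)\<^sup>2)"
    using sesq_cnj[of S K f g] psd_on_hermitian[OF S(2)] gf by simp
  have "(\<Sum>y\<in>S. K x y * g y) = K x x * v"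
    unfolding g_def using S(1) x by (simp add: if_distrib[of "\<lambda>c. t * c" for t] cong: if_cong)
  then have gg: "sesq S K g g = of_real ((cmod v)\<^sup>2) * K x x"
    using gK[of g] by (simp only: vv[symmetric] mult_ac)
  have "0 \<le> sesq S K (\<lambda>z. f z + c * g z) (\<lambda>z. f z + c * g z)"
    by (rule psd_on_nonneg[OF S(2)])
  also have "\<dots> = of_real (- 2 * s * (cmod v)\<^sup>2) + of_real (s\<^sup>2 * (cmod v)\<^sup>2) * K x x"
    unfolding sesq_add_left sesq_add_right sesq_scale_left sesq_scale_right null gf fg gg
    by (simp add: c_def power2_eq_square algebra_simps)
  finally have "0 \<le> - 2 * s * (cmod v)\<^sup>2 + s\<^sup>2 * (cmod v)\<^sup>2 * Re (K x x)"
    by (simp add: less_eq_complex_def)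
  also have "\<dots> = s * (cmod v)\<^sup>2 * (s * Re (K x x) - 2)"
    by (simp add: algebra_simps power2_eq_square)
  finally have "0 \<le> s * (cmod v)\<^sup>2 * (s * Re (K x x) - 2)" .
  moreover have "0 < s" by (simp add: s_def)
  moreover have "s * Re (K x x) < 2"
  proof -
    have "s * (1 + \<bar>Re (K x x)\<bar>) = 1" by (simp add: s_def)
    moreover have "s * Re (K x x) \<le> s * \<bar>Re (K x x)\<bar>"
      using \<open>0 < s\<close> by (intro mult_left_mono) auto
    ultimately show ?thesis using \<open>0 < s\<close> by (simp only: distrib_left)
  qed
  ultimately show False
    using v by (smt (verit) mult_pos_neg zero_less_mult_iff zero_less_power)
qed

text \<open>Gram-Schmidt, one point \<open>m\<close> of the subspace at a time. With
  \<open>q\<close> the part of the unit vector at \<open>m\<close> orthogonal to the earlier points,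
  the remainder \<open>r\<close> of \<open>h\<close> is corrected by a multiple of \<open>q\<close>.
  If \<open>q\<close> is null, division is impossible, but then \<open>r\<close> is already
  orthogonal to \<open>q\<close> by \<open>psd_on_null\<close>, and there is nothing to correct. The
  vector \<open>h\<close> is generalized in the induction because the hypothesis is applied both to
  \<open>h\<close> and to the unit vector at \<open>m\<close>.\<close>

lemma psd_on_projection:
  assumes "finite M" "finite S" "psd_on S K" "M \<subseteq> S"
  shows "\<exists>w. (\<forall>z. z \<notin> M \<longrightarrow> w z = 0) \<and> (\<forall>y\<in>M. (\<Sum>x\<in>S. (h x - w x) * K x y) = 0)"
  using assms(1,4)
proof (induction M arbitrary: h rule: finite_induct)
  case empty
  show ?case by (rule exI[of _ "\<lambda>_. 0"]) simp
next
  case (insert m M)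
  define L where "L = (\<lambda>f y. \<Sum>x\<in>S. f x * K x y)"
  have Llin: "L (\<lambda>x. f x - c * f' x) y = L f y - c * L f' y" for f f' c y
    by (simp add: L_def sum_subtractf sum_distrib_left algebra_simps)
  obtain w where w: "\<And>z. z \<notin> M \<Longrightarrow> w z = 0" "\<And>y. y \<in> M \<Longrightarrow> L (\<lambda>x. h x - w x) y = 0"
    using insert.IH[of h] insert.prems unfolding L_def by blast
  obtain u where u: "\<And>z. z \<notin> M \<Longrightarrow> u z = 0"
      "\<And>y. y \<in> M \<Longrightarrow> L (\<lambda>x. (if x = m then 1 else 0) - u x) y = 0"
    using insert.IH[of "\<lambda>x. if x = m then 1 else 0"] insert.prems unfolding L_def by blast
  define r where "r = (\<lambda>x. h x - w x)"
  define q where "q = (\<lambda>x. (if x = m then 1 else 0) - u x)"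
  have r0: "L r y = 0" and q0: "L q y = 0" if "y \<in> M" for y
    unfolding r_def q_def using w(2) u(2) that by blast+
  have qm: "q m = 1" using u(1) insert.hyps by (simp add: q_def)
  \<comment> \<open>\<open>q\<close> is 1 at \<open>m\<close> and otherwise supported on
    \<open>M\<close>, where \<open>L f\<close> vanishes, so pairing with \<open>q\<close> evaluates
    \<open>L f\<close> at \<open>m\<close>.\<close>
  have pair: "(\<Sum>y\<in>S. L f y * cnj (q y)) = L f m" if "\<And>y. y \<in> M \<Longrightarrow> L f y = 0" for f
  proof -
    have "(\<Sum>y\<in>S. L f y * cnj (q y)) = (\<Sum>y\<in>{m}. L f y * cnj (q y))"
      by (rule sum.mono_neutral_right) (use that u(1) assms(2) insert.prems in \<open>auto simp: q_def\<close>)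
    then show ?thesis by (simp add: qm)
  qed
  \<comment> \<open>\<open>L\<close> is linear in its vector while \<open>sesq\<close> conjugates
    its left argument, hence the conjugates.\<close>
  have pair': "(\<Sum>y\<in>S. L f y * cnj (g y)) = sesq S K (\<lambda>x. cnj (f x)) (\<lambda>x. cnj (g x))" for f g
    by (simp add: sesq_right L_def)
  have "\<exists>c. L r m = c * L q m"
  proof (cases "L q m = 0")
    case True
    then have "sesq S K (\<lambda>x. cnj (q x)) (\<lambda>x. cnj (q x)) = 0"
      using pair[OF q0] pair'[of q q] by simp
    then have "(\<Sum>y\<in>S. K x y * cnj (q y)) = 0" if "x \<in> S" for x
      using psd_on_null[OF assms(2,3) _ that] by blast
    then have "sesq S K (\<lambda>x. cnj (r x)) (\<lambda>x. cnj (q x)) = 0"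
      unfolding sesq_left by simp
    then have "L r m = 0"
      using pair[OF r0] pair'[of r q] by simp
    then show ?thesis by auto
  next
    case False
    then show ?thesis by (intro exI[of _ "L r m / L q m"]) simp
  qed
  then obtain c where c: "L r m = c * L q m" by blast
  \<comment> \<open>\<open>h - ?w\<close> is \<open>r - c q\<close>, and the support of
    \<open>q\<close> adds only the point \<open>m\<close>.\<close>
  let ?w = "\<lambda>x. w x + c * q x"
  have "L (\<lambda>x. r x - c * q x) y = 0" if "y \<in> insert m M" for y
    unfolding Llin using that c r0 q0 by auto
  then have "\<forall>y\<in>insert m M. (\<Sum>x\<in>S. (h x - ?w x) * K x y) = 0"
    by (simp add: L_def r_def diff_diff_eq)
  moreover have "\<forall>z. z \<notin> insert m M \<longrightarrow> ?w z = 0"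
    using w(1) u(1) by (simp add: q_def)
  ultimately show ?case by (intro exI[of _ ?w] conjI)
qed

text \<open>
  Each \<open>x \<in> P\<close> is projected onto the span of \<open>M\<close>, and its missing inner products with \<open>E\<close> are
  declared to be those of the projection. Then \<open>x\<close> minus its projection is orthogonal to all of
  \<open>M \<union> E\<close>, so the form splits into one part supported on \<open>P \<union> M\<close> and one on \<open>M \<union> E\<close>.
\<close>

lemma psd_on_completion:
  assumes fin: "finite P" "finite M" "finite E"
    and disj: "P \<inter> M = {}" "P \<inter> E = {}" "M \<inter> E = {}"
    and psd: "psd_on (P \<union> M) K" "psd_on (M \<union> E) K"
  obtains K' where "psd_on (P \<union> M \<union> E) K'"
    and "\<And>x y. \<not> (x \<in> P \<and> y \<in> E) \<Longrightarrow> \<not> (x \<in> E \<and> y \<in> P) \<Longrightarrow> K' x y = K x y"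
proof -
  have "\<exists>w. \<forall>y\<in>M. K x y = (\<Sum>z\<in>M. w z * K z y)" if x: "x \<in> P" for x
  proof -
    obtain w where w: "\<And>z. z \<notin> M \<Longrightarrow> w z = 0"
        "\<And>y. y \<in> M \<Longrightarrow> (\<Sum>z\<in>P \<union> M. ((if z = x then 1 else 0) - w z) * K z y) = 0"
      using psd_on_projection[of M "P \<union> M" K "\<lambda>z. if z = x then 1 else 0"] fin psd by auto
    have "K x y = (\<Sum>z\<in>M. w z * K z y)" if "y \<in> M" for y
    proof -
      have "(\<Sum>z\<in>P \<union> M. w z * K z y) = (\<Sum>z\<in>M. w z * K z y)"
        by (rule sum.mono_neutral_right) (use w(1) fin in auto)
      moreover have "(\<Sum>z\<in>P \<union> M. (if z = x then 1 else 0) * K z y) = K x y"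
        using fin x by (simp add: if_distrib[of "\<lambda>c. c * t" for t] cong: if_cong)
      ultimately show ?thesis
        using w(2)[OF that] by (simp add: left_diff_distrib sum_subtractf)
    qed
    then show ?thesis by blast
  qed
  then obtain w where w: "\<And>x y. x \<in> P \<Longrightarrow> y \<in> M \<Longrightarrow> K x y = (\<Sum>z\<in>M. w x z * K z y)"
    by metis
  define X where "X = (\<lambda>x y. \<Sum>z\<in>M. w x z * K z y)"
  define K' where "K' = (\<lambda>x y. if x \<in> P \<and> y \<in> E then X x y
    else if x \<in> E \<and> y \<in> P then cnj (X y x) else K x y)"
  define S where "S = P \<union> M \<union> E"
  have finS: "finite S" using fin by (simp add: S_def)
  have agree: "K' x y = K x y" if "\<not> (x \<in> P \<and> y \<in> E)" "\<not> (x \<in> E \<and> y \<in> P)" for x y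
    unfolding K'_def using that by auto
  have psd': "psd_on (P \<union> M) K'" "psd_on (M \<union> E) K'"
    using psd_on_cong[of "P \<union> M" K' K] psd_on_cong[of "M \<union> E" K' K] psd agree disj by blast+
  have herm: "cnj (K' x y) = K' y x" if "x \<in> S" "y \<in> S" for x y
  proof (cases "(x \<in> P \<and> y \<in> E) \<or> (x \<in> E \<and> y \<in> P)")
    case True
    then show ?thesis using disj by (auto simp: K'_def)
  next
    case False
    then have "{x, y} \<subseteq> P \<union> M \<or> {x, y} \<subseteq> M \<union> E" using that by (auto simp: S_def)
    then show ?thesis using psd_on_hermitian[OF psd'(1)] psd_on_hermitian[OF psd'(2)] by auto
  qed
  have "0 \<le> sesq S K' f f" for f
  proof -
    \<comment> \<open>\<open>g\<close> is the projection onto \<open>M\<close> of the part of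
      \<open>f\<close> on \<open>P\<close>; \<open>w\<close> is conjugated because it acts in the
      left slot, which \<open>sesq\<close> conjugates. Then \<open>f = r + s\<close>, where
      \<open>r\<close> is the part on \<open>P\<close> minus its projection.\<close>
    define g where "g = (\<lambda>z. \<Sum>x\<in>P. f x * cnj (w x z))"
    define r where "r = (\<lambda>z. if z \<in> P then f z else if z \<in> M then - g z else 0)"
    define s where "s = (\<lambda>z. if z \<in> P then 0 else if z \<in> M then f z + g z else f z)"
    have col: "(\<Sum>x\<in>S. cnj (r x) * K' x y) = 0" if y: "y \<in> M \<union> E" for y
    proof -
      \<comment> \<open>For \<open>y\<close> in \<open>E\<close> this is how \<open>K'\<close> was
        prescribed; for \<open>y\<close> in \<open>M\<close> it is the defining property of the
        projection coefficients \<open>w\<close>.\<close>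
      have K'P: "K' x y = X x y" if "x \<in> P" for x
        using w[OF that] y that disj by (auto simp: K'_def X_def)
      have K'M: "K' z y = K z y" if "z \<in> M" for z
        using that disj by (auto simp: K'_def)
      have "(\<Sum>x\<in>S. cnj (r x) * K' x y) = (\<Sum>x\<in>P \<union> M. cnj (r x) * K' x y)"
        by (rule sum.mono_neutral_right) (use finS in \<open>auto simp: S_def r_def\<close>)
      also have "\<dots> = (\<Sum>x\<in>P. cnj (r x) * K' x y) + (\<Sum>x\<in>M. cnj (r x) * K' x y)"
        using fin disj by (simp add: sum.union_disjoint)
      also have "(\<Sum>x\<in>P. cnj (r x) * K' x y) = (\<Sum>x\<in>P. cnj (f x) * X x y)"
        by (rule sum.cong) (auto simp: r_def K'P)
      also have "\<dots> = (\<Sum>z\<in>M. cnj (g z) * K z y)"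
        unfolding X_def g_def sum_distrib_left
        by (subst sum.swap) (simp add: sum_distrib_right mult.assoc)
      also have "(\<Sum>x\<in>M. cnj (r x) * K' x y) = (\<Sum>z\<in>M. - (cnj (g z) * K z y))"
        by (rule sum.cong) (use disj in \<open>auto simp: r_def K'M\<close>)
      finally show ?thesis by (simp add: sum_negf)
    qed
    have rs: "sesq S K' r s = 0"
      unfolding sesq_right
    proof (rule sum.neutral, rule ballI)
      fix y assume "y \<in> S"
      then show "(\<Sum>x\<in>S. cnj (r x) * K' x y) * s y = 0"
        using col[of y] by (cases "y \<in> P") (auto simp: s_def S_def)
    qed
    have sr: "sesq S K' s r = 0"
      using sesq_cnj[of S K' s r] herm rs by simp
    have "sesq S K' r r = sesq (P \<union> M) K' r r"
      by (rule sesq_mono_neutral) (use finS in \<open>auto simp: S_def r_def\<close>)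
    then have rr: "0 \<le> sesq S K' r r" using psd_on_nonneg[OF psd'(1)] by metis
    have "sesq S K' s s = sesq (M \<union> E) K' s s"
      by (rule sesq_mono_neutral) (use finS in \<open>auto simp: S_def s_def\<close>)
    then have ss: "0 \<le> sesq S K' s s" using psd_on_nonneg[OF psd'(2)] by metis
    have "sesq S K' f f = sesq S K' (\<lambda>x. r x + s x) (\<lambda>x. r x + s x)"
      by (rule sesq_cong) (use disj in \<open>auto simp: S_def r_def s_def\<close>)
    also have "\<dots> = sesq S K' r r + sesq S K' s s"
      by (simp add: sesq_add_left sesq_add_right rs sr)
    finally show ?thesis using rr ss by simp
  qed
  then have "psd_on S K'" using herm by (simp add: psd_on_def)
  then show thesis using that agree by (simp add: S_def)
qed

section \<open>Kernel versions of the operator system axioms\<close>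

lemma sesq_add_kernel:
  "sesq S (\<lambda>x y. K x y + K' x y) f g = sesq S K f g + sesq S K' f g"
  by (simp add: sesq_def sum.distrib algebra_simps)

lemma sesq_uminus_kernel: "sesq S (\<lambda>x y. - K x y) f g = - sesq S K f g"
  by (simp add: sesq_def sum_negf)

lemma sesq_sum_left:
  "sesq S K (\<lambda>z. \<Sum>x\<in>T. c x * F x z) g = (\<Sum>x\<in>T. cnj (c x) * sesq S K (F x) g)"
  by (induction T rule: infinite_finite_induct)
     (simp_all add: sesq_add_left sesq_scale_left, simp_all add: sesq_def)

lemma sesq_sum_right:
  "sesq S K f (\<lambda>z. \<Sum>x\<in>T. c x * F x z) = (\<Sum>x\<in>T. c x * sesq S K f (F x))"
  by (induction T rule: infinite_finite_induct)
     (simp_all add: sesq_add_right sesq_scale_right, simp_all add: sesq_def)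

lemma sesq_scalar:
  assumes "finite S"
  shows "sesq S (\<lambda>x y. if x = y then of_real r else 0) f f = of_real (r * (\<Sum>x\<in>S. (cmod (f x))\<^sup>2))"
proof -
  have "(\<Sum>y\<in>S. (if x = y then of_real r else 0) * f y) = of_real r * f x" if "x \<in> S" for x
    using assms that by (simp add: if_distrib[of "\<lambda>c. c * t" for t] cong: if_cong)
  then have "sesq S (\<lambda>x y. if x = y then of_real r else 0) f f
      = (\<Sum>x\<in>S. of_real r * (f x * cnj (f x)))"
    unfolding sesq_left by (intro sum.cong refl) simp
  also have "\<dots> = (\<Sum>x\<in>S. of_real (r * (cmod (f x))\<^sup>2))"
    by (simp only: complex_norm_square of_real_mult)
  finally show ?thesis by (simp add: sum_distrib_left)
qed

lemma psd_on_add: "psd_on S K \<Longrightarrow> psd_on S K' \<Longrightarrow> psd_on S (\<lambda>x y. K x y + K' x y)"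
  by (simp add: psd_on_def sesq_add_kernel)

lemma psd_on_scalar:
  assumes "finite S" "0 \<le> r"
  shows "psd_on S (\<lambda>x y. if x = y then of_real r else 0)"
  using assms by (simp add: psd_on_def sesq_scalar less_eq_complex_def sum_nonneg)

text \<open>This is the Gram kernel of the family of vectors \<open>F x\<close>: its form at
  \<open>f\<close> is the form of \<open>K\<close> at the linear combination of the family with
  coefficients \<open>f\<close>. It yields stability of the cones under
  \<open>compress\<close>.\<close>

lemma psd_on_congruence:
  assumes "psd_on S' K"
  shows "psd_on S (\<lambda>x y. sesq S' K (F x) (F y))"
proof -
  have "sesq S (\<lambda>x y. sesq S' K (F x) (F y)) f f
      = sesq S' K (\<lambda>z. \<Sum>x\<in>S. f x * F x z) (\<lambda>z. \<Sum>x\<in>S. f x * F x z)" for f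
    unfolding sesq_sum_left sesq_left[of S] sesq_sum_right
    by (simp add: mult.commute)
  moreover have "cnj (sesq S' K (F x) (F y)) = sesq S' K (F y) (F x)" for x y
    using sesq_cnj[of S' K "F y" "F x"] psd_on_hermitian[OF assms] by simp
  ultimately show ?thesis
    using psd_on_nonneg[OF assms] by (simp add: psd_on_def)
qed

text \<open>The form is both nonnegative and nonpositive, so each unit vector is null, and
  \<open>psd_on_null\<close> turns this into the vanishing of a column of \<open>K\<close>.\<close>

lemma psd_on_proper:
  assumes "finite S" "psd_on S K" "psd_on S (\<lambda>x y. - K x y)" "x \<in> S" "y \<in> S"
  shows "K x y = 0"
proof -
  let ?f = "\<lambda>z. if z = y then 1 else 0 :: complex"
  have "sesq S K ?f ?f = 0"
    using psd_on_nonneg[OF assms(2), of ?f] psd_on_nonneg[OF assms(3), of ?f]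
    unfolding sesq_uminus_kernel by (simp add: less_eq_complex_def complex_eq_iff)
  then have "(\<Sum>z\<in>S. K x z * ?f z) = 0"
    by (rule psd_on_null[OF assms(1,2) _ assms(4)])
  then show ?thesis
    using assms by (simp add: if_distrib[of "\<lambda>c. t * c" for t] cong: if_cong)
qed

lemma hermitian_order_unit:
  assumes S: "finite S" and herm: "\<And>x y. x \<in> S \<Longrightarrow> y \<in> S \<Longrightarrow> cnj (K x y) = K y x"
  shows "\<exists>r>0. psd_on S (\<lambda>x y. (if x = y then of_real r else 0) + K x y)"
proof -
  \<comment> \<open>The sum of the moduli of all entries bounds the form on unit vectors; the extra
    1 keeps \<open>r\<close> positive when \<open>K\<close> is zero or \<open>S\<close> is
    empty.\<close>
  define r where "r = 1 + (\<Sum>x\<in>S. \<Sum>y\<in>S. cmod (K x y))"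
  have r: "0 < r" unfolding r_def by (intro add_pos_nonneg sum_nonneg) auto
  have "0 \<le> sesq S (\<lambda>x y. (if x = y then of_real r else 0) + K x y) f f" for f
  proof -
    define s where "s = (\<Sum>x\<in>S. (cmod (f x))\<^sup>2)"
    have s0: "0 \<le> s" by (simp add: s_def sum_nonneg)
    have "cmod (f x) \<le> sqrt s" if "x \<in> S" for x
      unfolding s_def by (rule real_le_rsqrt) (use S that in \<open>auto intro: member_le_sum\<close>)
    then have fxy: "cmod (f x) * cmod (f y) \<le> s" if "x \<in> S" "y \<in> S" for x y
      using mult_mono[of "cmod (f x)" "sqrt s" "cmod (f y)" "sqrt s"] that s0 by simp
    have "cmod (sesq S K f f) \<le> (\<Sum>x\<in>S. \<Sum>y\<in>S. cmod (K x y) * s)"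
      unfolding sesq_def
    proof (intro order_trans[OF norm_sum] sum_mono)
      fix x y assume "x \<in> S" "y \<in> S"
      then have "cmod (K x y) * (cmod (f x) * cmod (f y)) \<le> cmod (K x y) * s"
        by (intro mult_left_mono fxy) auto
      then show "cmod (cnj (f x) * K x y * f y) \<le> cmod (K x y) * s"
        by (simp add: norm_mult mult_ac)
    qed
    also have "\<dots> = (r - 1) * s" by (simp add: r_def sum_distrib_right)
    finally have "\<bar>Re (sesq S K f f)\<bar> \<le> r * s"
      using abs_Re_le_cmod[of "sesq S K f f"] s0 by (simp add: algebra_simps)
    moreover have "Im (sesq S K f f) = 0"
      using sesq_cnj[of S K f f] herm by (simp add: complex_eq_iff)
    ultimately show ?thesis
      unfolding sesq_add_kernel sesq_scalar[OF S] s_def[symmetric]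
      by (simp add: less_eq_complex_def)
  qed
  then have "psd_on S (\<lambda>x y. (if x = y then of_real r else 0) + K x y)"
    using herm by (simp add: psd_on_def)
  then show ?thesis using r by blast
qed

lemma psd_on_archimedean:
  assumes S: "finite S" and herm: "\<And>x y. x \<in> S \<Longrightarrow> y \<in> S \<Longrightarrow> cnj (K x y) = K y x"
    and psd: "\<And>\<epsilon>. 0 < \<epsilon> \<Longrightarrow> psd_on S (\<lambda>x y. (if x = y then of_real \<epsilon> else 0) + K x y)"
  shows "psd_on S K"
proof -
  have "0 \<le> sesq S K f f" for f
  proof -
    define s where "s = (\<Sum>x\<in>S. (cmod (f x))\<^sup>2)"
    have s0: "0 \<le> s" by (simp add: s_def sum_nonneg)
    have "0 \<le> Re (sesq S K f f)"
    proof (rule field_le_epsilon)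
      fix e :: real assume e: "0 < e"
      \<comment> \<open>At this scale the perturbation contributes \<open>e s / (1 + s)\<close>, at
        most \<open>e\<close>; the 1 in the denominator covers a vector that vanishes on
        \<open>S\<close>.\<close>
      then have "0 < e / (1 + s)" using s0 by simp
      from psd_on_nonneg[OF psd[OF this], of f] have "0 \<le> e / (1 + s) * s + Re (sesq S K f f)"
        unfolding sesq_add_kernel sesq_scalar[OF S] s_def[symmetric]
        by (simp add: less_eq_complex_def)
      moreover have "e / (1 + s) * s \<le> e" using e s0 by (simp add: field_simps)
      ultimately show "0 \<le> Re (sesq S K f f) + e" by simp
    qed
    moreover have "Im (sesq S K f f) = 0"
      using sesq_cnj[of S K f f] herm by (simp add: complex_eq_iff)
    ultimately show ?thesis by (simp add: less_eq_complex_def)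
  qed
  then show ?thesis using herm by (simp add: psd_on_def)
qed

section \<open>Extending block Toeplitz kernels\<close>

text \<open>\<open>\<tau> a b\<close> is the symbol of the block \<open>(a, b)\<close>; the second
  components of the index pairs are positions inside the Toeplitz matrices. On pairs, a matrix of
  Toeplitz matrices and a Toeplitz matrix of blocks are the same kernel, so no permutation of
  indices intervenes.\<close>

definition toeplitz_kernel ::
    "('a \<Rightarrow> 'a \<Rightarrow> int \<Rightarrow> complex) \<Rightarrow> 'a \<times> nat \<Rightarrow> 'a \<times> nat \<Rightarrow> complex" where
  "toeplitz_kernel \<tau> x y = \<tau> (fst x) (fst y) (int (snd x) - int (snd y))"

lemma toeplitz_extend_one:
  assumes B: "finite B" and N: "0 < N" and psd: "psd_on (B \<times> {..<N}) (toeplitz_kernel \<tau>)"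
  obtains \<tau>' where "psd_on (B \<times> {..<Suc N}) (toeplitz_kernel \<tau>')"
    and "\<And>a b k. \<bar>k\<bar> < int N \<Longrightarrow> \<tau>' a b k = \<tau> a b k"
proof -
  define P M E where "P = B \<times> {N}" and "M = B \<times> {1..<N}" and "E = B \<times> {0 :: nat}"
  have fin: "finite P" "finite M" "finite E" using B by (auto simp: P_def M_def E_def)
  have disj: "P \<inter> M = {}" "P \<inter> E = {}" "M \<inter> E = {}" using N by (auto simp: P_def M_def E_def)
  have "M \<union> E = B \<times> {..<N}" using N by (auto simp: M_def E_def)
  then have psdE: "psd_on (M \<union> E) (toeplitz_kernel \<tau>)" using psd by simp
  \<comment> \<open>Moving all positions up by one carries the section without the last position
    onto the section without the first, and keeps all differences.\<close>
  have "P \<union> M = map_prod id Suc ` (B \<times> {..<N})"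
  proof -
    have "Suc ` {..<N} = {1..<Suc N}" by (simp add: image_Suc_lessThan atLeastLessThanSuc_atLeastAtMost)
    then have "map_prod id Suc ` (B \<times> {..<N}) = B \<times> {1..<Suc N}"
      by (simp add: map_prod_surj_on)
    then show ?thesis using N by (auto simp: P_def M_def)
  qed
  moreover have "inj_on (map_prod id Suc) (B \<times> {..<N})" by (auto simp: inj_on_def)
  moreover have "toeplitz_kernel \<tau> (map_prod id Suc x) (map_prod id Suc y) = toeplitz_kernel \<tau> x y" for x y
    by (simp add: toeplitz_kernel_def)
  ultimately have psdP: "psd_on (P \<union> M) (toeplitz_kernel \<tau>)"
    using psd by (simp add: psd_on_reindex)
  obtain K' where K': "psd_on (P \<union> M \<union> E) K'"
      "\<And>x y. \<not> (x \<in> P \<and> y \<in> E) \<Longrightarrow> \<not> (x \<in> E \<and> y \<in> P) \<Longrightarrow> K' x y = toeplitz_kernel \<tau> x y"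
    using psd_on_completion[OF fin disj psdP psdE] by metis
  \<comment> \<open>Among positions up to \<open>N\<close> the differences \<open>N\<close> and
    \<open>-N\<close> occur only between the two end positions, so the values of a symbol there can
    be read off from \<open>K'\<close>; \<open>0 < N\<close> keeps the two cases apart.\<close>
  define \<tau>' where "\<tau>' = (\<lambda>a b k. if k = int N then K' (a, N) (b, 0)
    else if k = - int N then K' (a, 0) (b, N) else \<tau> a b k)"
  have S: "P \<union> M \<union> E = B \<times> {..<Suc N}" using N by (auto simp: P_def M_def E_def)
  have "K' x y = toeplitz_kernel \<tau>' x y" if xy: "x \<in> B \<times> {..<Suc N}" "y \<in> B \<times> {..<Suc N}" for x y
  proof -
    obtain a i b j where [simp]: "x = (a, i)" "y = (b, j)" by (metis surj_pair)
    have ij: "i \<le> N" "j \<le> N" "a \<in> B" "b \<in> B" using xy by auto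
    consider "i = N" "j = 0" | "i = 0" "j = N" | "\<not> (i = N \<and> j = 0)" "\<not> (i = 0 \<and> j = N)" by blast
    then show ?thesis
    proof cases
      case 3
      then have "int i - int j \<noteq> int N" "int i - int j \<noteq> - int N" using ij by auto
      moreover have "K' x y = toeplitz_kernel \<tau> x y"
        by (rule K'(2)) (use 3 in \<open>auto simp: P_def E_def\<close>)
      ultimately show ?thesis by (simp add: toeplitz_kernel_def \<tau>'_def)
    qed (use N in \<open>auto simp: toeplitz_kernel_def \<tau>'_def\<close>)
  qed
  then have "psd_on (B \<times> {..<Suc N}) (toeplitz_kernel \<tau>')"
    using psd_on_cong[of "B \<times> {..<Suc N}" K' "toeplitz_kernel \<tau>'"] K'(1) S by simp
  moreover have "\<tau>' a b k = \<tau> a b k" if "\<bar>k\<bar> < int N" for a b k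
    using that by (auto simp: \<tau>'_def)
  ultimately show thesis using that by blast
qed

lemma toeplitz_extend:
  assumes "finite B" "0 < n" "n \<le> m" "psd_on (B \<times> {..<n}) (toeplitz_kernel \<tau>)"
  shows "\<exists>\<tau>'. psd_on (B \<times> {..<m}) (toeplitz_kernel \<tau>') \<and>
    (\<forall>a b k. \<bar>k\<bar> < int n \<longrightarrow> \<tau>' a b k = \<tau> a b k)"
  using assms(3)
proof (induction m rule: dec_induct)
  case base
  show ?case using assms(4) by blast
next
  case (step N)
  then obtain \<tau>1 where 1: "psd_on (B \<times> {..<N}) (toeplitz_kernel \<tau>1)"
      "\<And>a b k. \<bar>k\<bar> < int n \<Longrightarrow> \<tau>1 a b k = \<tau> a b k" by blast
  obtain \<tau>2 where "psd_on (B \<times> {..<Suc N}) (toeplitz_kernel \<tau>2)"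
      "\<And>a b k. \<bar>k\<bar> < int N \<Longrightarrow> \<tau>2 a b k = \<tau>1 a b k"
    using toeplitz_extend_one[OF assms(1) _ 1(1)] step.hyps assms(2) by (metis order_less_le_trans)
  then show ?case using 1(2) step.hyps by (intro exI[of _ \<tau>2]) auto
qed

section \<open>Complete quotient maps\<close>

lemma matsD:
  assumes "A \<in> mats S p"
  shows "A \<in> carrier_mat p p" "dim_row A = p" "dim_col A = p"
    "\<And>i j. i < p \<Longrightarrow> j < p \<Longrightarrow> A $$ (i, j) \<in> S"
  using assms by (auto simp: mats_def)

text \<open>The requirement \<open>lift\<close> is exact, which is more than the quotient cone asks
  for: a preimage in the cone stays there after adding \<epsilon> times the unit, so the correction
  from the kernel can be zero. For the forward direction, \<open>star\<close> and
  \<open>unit\<close> make the image of a class selfadjoint and turn its perturbations into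
  perturbations in \<open>T\<close>.\<close>

lemma complete_quotient_mapI:
  fixes R :: "'a opsys" and T :: "'b opsys"
  assumes R: "operator_system R" and T: "operator_system T"
    and cp: "cp_map R T \<phi>"
    and surj: "\<phi> ` carrier R = carrier T"
    and star: "\<And>x. x \<in> carrier R \<Longrightarrow> \<phi> (star R x) = star T (\<phi> x)"
    and unit: "\<phi> (ounit R) = ounit T"
    and unit_pos: "\<And>p \<epsilon>. 0 < p \<Longrightarrow> 0 < \<epsilon> \<Longrightarrow> scaled_unit R \<epsilon> p \<in> cone R p"
    and lift: "\<And>p B. 0 < p \<Longrightarrow> B \<in> cone T p \<Longrightarrow> \<exists>A\<in>cone R p. map_mat \<phi> A = B"
  shows "complete_quotient_map R T \<phi>"
proof -
  interpret R: operator_system R by (rule R)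
  interpret T: operator_system T by (rule T)
  define J where "J = a_kernel R T \<phi>"
  define Q where "Q = opsys_quotient R J"
  define \<pi> where "\<pi> = (\<lambda>x. J +>\<^bsub>R\<^esub> x)"
  define \<psi> where "\<psi> = (\<lambda>X. the_elem (\<phi> ` X))"
  have hom: "\<phi> \<in> LinearCombinations.module_hom class_ring R T"
    using cp by (simp add: cp_map_def)
  have \<phi>_closed: "\<phi> x \<in> carrier T" if "x \<in> carrier R" for x
    using LinearCombinations.module_hom_closed[OF hom] that by auto
  have \<phi>_add: "\<phi> (x \<oplus>\<^bsub>R\<^esub> y) = \<phi> x \<oplus>\<^bsub>T\<^esub> \<phi> y" if "x \<in> carrier R" "y \<in> carrier R" for x y
    by (rule LinearCombinations.module_hom_add[OF hom that])
  have \<phi>_smult: "\<phi> (c \<odot>\<^bsub>R\<^esub> x) = c \<odot>\<^bsub>T\<^esub> \<phi> x" if "x \<in> carrier R" for c x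
    by (rule LinearCombinations.module_hom_smult[OF hom _ that]) (simp add: class_ring_simps)
  have smultR: "c \<odot>\<^bsub>R\<^esub> x \<in> carrier R" if "x \<in> carrier R" for c x
    using that by (intro R.smult_closed) (simp_all add: class_ring_simps)
  have "\<phi> \<in> hom (add_monoid R) (add_monoid T)"
    by (rule homI) (simp_all add: \<phi>_closed \<phi>_add)
  then have "group_hom (add_monoid R) (add_monoid T) \<phi>"
    by (intro group_hom.intro group_hom_axioms.intro R.M.a_group T.M.a_group)
  then have h: "abelian_group_hom R T \<phi>"
    by (rule abelian_group_homI[OF R.M.abelian_group_axioms T.M.abelian_group_axioms])
  have J: "abelian_subgroup J R"
    unfolding J_def by (rule abelian_group_hom.abelian_subgroup_a_kernel[OF h])
  note \<phi>_zero = abelian_group_hom.hom_zero[OF h] and \<phi>_neg = abelian_group_hom.hom_a_inv[OF h]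
  have J_iff: "x \<in> J \<longleftrightarrow> x \<in> carrier R \<and> \<phi> x = \<zero>\<^bsub>T\<^esub>" for x
    by (simp add: J_def a_kernel_def')
  have J_zero: "\<zero>\<^bsub>R\<^esub> \<in> J" by (simp add: J_iff \<phi>_zero)
  have \<pi>_eq: "\<pi> x = {k \<oplus>\<^bsub>R\<^esub> x | k. k \<in> J}" for x
    by (auto simp: \<pi>_def a_r_coset_def')
  \<comment> \<open>\<open>\<phi>\<close> is constant on each coset, so its image is a singleton and
    \<open>the_elem\<close> is meaningful.\<close>
  have \<psi>\<pi>: "\<psi> (\<pi> x) = \<phi> x" if "x \<in> carrier R" for x
  proof -
    have "\<phi> ` \<pi> x = {\<phi> x}"
    proof
      show "\<phi> ` \<pi> x \<subseteq> {\<phi> x}"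
        unfolding \<pi>_eq using that by (auto simp: J_iff \<phi>_add \<phi>_closed)
      have "\<phi> x = \<phi> (\<zero>\<^bsub>R\<^esub> \<oplus>\<^bsub>R\<^esub> x)" using that by simp
      then show "{\<phi> x} \<subseteq> \<phi> ` \<pi> x"
        unfolding \<pi>_eq using J_zero by blast
    qed
    then show ?thesis by (simp add: \<psi>_def)
  qed
  have Qsimps: "carrier Q = \<pi> ` carrier R" "add Q = (\<lambda>X Y. X <+>\<^bsub>R\<^esub> Y)"
      "module.smult Q = (\<lambda>c X. \<Union>x\<in>X. J +>\<^bsub>R\<^esub> (c \<odot>\<^bsub>R\<^esub> x))"
      "cone Q = (\<lambda>p. {map_mat \<pi> h | h. h \<in> sa_mats R (carrier R) p \<and>
         (\<forall>\<epsilon>>0. \<exists>k\<in>sa_mats R J p. mat_add R (mat_add R (scaled_unit R \<epsilon> p) h) k \<in> cone R p)})"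
    by (auto simp: Q_def opsys_quotient_def \<pi>_def A_RCOSETS_def')
  have \<pi>_add: "\<pi> x \<oplus>\<^bsub>Q\<^esub> \<pi> y = \<pi> (x \<oplus>\<^bsub>R\<^esub> y)" if "x \<in> carrier R" "y \<in> carrier R" for x y
    unfolding Qsimps \<pi>_def using that by (rule abelian_subgroup.a_rcos_sum[OF J])
  have \<pi>_eqI: "\<pi> x = \<pi> y" if "x \<in> carrier R" "y \<in> carrier R" "\<phi> x = \<phi> y" for x y
  proof -
    have "y \<oplus>\<^bsub>R\<^esub> \<ominus>\<^bsub>R\<^esub> x \<in> J"
      using that by (simp add: J_iff \<phi>_closed \<phi>_add \<phi>_neg T.M.r_neg)
    then have "y \<in> \<pi> x" unfolding \<pi>_def using abelian_subgroup.a_rcos_module[OF J] that by blast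
    then show ?thesis unfolding \<pi>_def using abelian_subgroup.a_repr_independence'[OF J] that by blast
  qed
  have \<pi>_smult: "c \<odot>\<^bsub>Q\<^esub> \<pi> x = \<pi> (c \<odot>\<^bsub>R\<^esub> x)" if x: "x \<in> carrier R" for c x
  proof -
    \<comment> \<open>All representatives contribute the same coset to the union defining the scalar
      multiple; the union is nonempty since \<open>x\<close> lies in its own coset.\<close>
    have z: "\<pi> (c \<odot>\<^bsub>R\<^esub> z) = \<pi> (c \<odot>\<^bsub>R\<^esub> x)" if zx: "z \<in> \<pi> x" for z
    proof -
      obtain k where "k \<in> J" "z = k \<oplus>\<^bsub>R\<^esub> x" using zx by (auto simp: \<pi>_eq)
      then have "z \<in> carrier R" "\<phi> z = \<phi> x" using x by (auto simp: J_iff \<phi>_closed \<phi>_add)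
      then show ?thesis using x by (intro \<pi>_eqI) (simp_all add: smultR \<phi>_smult)
    qed
    have "x \<in> \<pi> x" unfolding \<pi>_def using x abelian_subgroup.a_rcos_self[OF J] by blast
    then have "(\<Union>z\<in>\<pi> x. \<pi> (c \<odot>\<^bsub>R\<^esub> z)) = \<pi> (c \<odot>\<^bsub>R\<^esub> x)" using z by blast
    then show ?thesis by (simp add: Qsimps \<pi>_def)
  qed
  have inj: "inj_on \<psi> (carrier Q)"
  proof (rule inj_onI)
    fix X Y assume "X \<in> carrier Q" "Y \<in> carrier Q" and eq: "\<psi> X = \<psi> Y"
    then obtain x y where xy: "x \<in> carrier R" "y \<in> carrier R" "X = \<pi> x" "Y = \<pi> y"
      by (auto simp: Qsimps)
    then show "X = Y" using eq \<pi>_eqI[of x y] by (simp add: \<psi>\<pi>)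
  qed
  have bij: "bij_betw \<psi> (carrier Q) (carrier T)"
    unfolding bij_betw_def
  proof
    have "\<psi> ` carrier Q = \<phi> ` carrier R"
      by (simp add: Qsimps image_image \<psi>\<pi>)
    then show "\<psi> ` carrier Q = carrier T" using surj by simp
  qed (rule inj)
  have inv: "inv_into (carrier Q) \<psi> (\<phi> x) = \<pi> x" if "x \<in> carrier R" for x
    using inv_into_f_f[OF inj, of "\<pi> x"] that by (simp add: Qsimps \<psi>\<pi>)
  have unit_mat: "scaled_unit R \<epsilon> p \<in> mats (carrier R) p" for \<epsilon> p
    using R.unit_closed smultR by (auto simp: mats_def scaled_unit_def)

  have "cp_map Q T \<psi>"
    unfolding cp_map_def
  proof (intro conjI allI impI ballI)
    show "\<psi> \<in> LinearCombinations.module_hom class_ring Q T"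
      unfolding LinearCombinations.module_hom_def
      by (auto simp: Qsimps(1) \<psi>\<pi> \<pi>_add \<pi>_smult \<phi>_closed \<phi>_add \<phi>_smult smultR)
  next
    fix p :: nat and X
    assume p: "0 < p" and "X \<in> cone Q p"
    then obtain h where X: "X = map_mat \<pi> h" and h: "h \<in> sa_mats R (carrier R) p"
      and hk: "\<And>\<epsilon>. 0 < \<epsilon> \<Longrightarrow>
        \<exists>k\<in>sa_mats R J p. mat_add R (mat_add R (scaled_unit R \<epsilon> p) h) k \<in> cone R p"
      by (auto simp: Qsimps)
    have hm: "h \<in> mats (carrier R) p" and hs: "mat_star R h = h"
      using h by (auto simp: sa_mats_def)
    note hd = matsD[OF hm]
    have "map_mat \<psi> X = map_mat \<phi> h"
      unfolding X by (rule eq_matI) (use hd in \<open>auto simp: \<psi>\<pi>\<close>)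
    \<comment> \<open>\<open>\<phi>\<close> kills the correction \<open>k\<close> and preserves the
      unit, so membership for each \<epsilon> becomes the hypothesis of the Archimedean axiom in
      \<open>T\<close>.\<close>
    moreover have "map_mat \<phi> h \<in> cone T p"
    proof (rule T.archimedean[OF p])
      have "star T (\<phi> (h $$ (j, i))) = \<phi> (h $$ (i, j))" if "i < p" "j < p" for i j
      proof -
        have "h $$ (i, j) = mat_star R h $$ (i, j)" by (simp add: hs)
        then have "h $$ (i, j) = star R (h $$ (j, i))" using that hd by (simp add: mat_star_def)
        then show ?thesis using star hd(4) that by simp
      qed
      then have "mat_star T (map_mat \<phi> h) = map_mat \<phi> h"
        by (intro eq_matI) (use hd in \<open>auto simp: mat_star_def\<close>)
      then show "map_mat \<phi> h \<in> sa_mats T (carrier T) p"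
        using hd \<phi>_closed by (auto simp: sa_mats_def mats_def)
    next
      fix \<epsilon> :: real assume "0 < \<epsilon>"
      then obtain k where k: "k \<in> sa_mats R J p"
        and pos: "mat_add R (mat_add R (scaled_unit R \<epsilon> p) h) k \<in> cone R p"
        using hk by blast
      have kd: "k \<in> carrier_mat p p" "\<And>i j. i < p \<Longrightarrow> j < p \<Longrightarrow> k $$ (i, j) \<in> J"
        using k by (auto simp: sa_mats_def mats_def)
      have "map_mat \<phi> (mat_add R (mat_add R (scaled_unit R \<epsilon> p) h) k) \<in> cone T p"
        using cp p pos by (auto simp: cp_map_def)
      moreover have "map_mat \<phi> (mat_add R (mat_add R (scaled_unit R \<epsilon> p) h) k)
          = mat_add T (scaled_unit T \<epsilon> p) (map_mat \<phi> h)"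
      proof (rule eq_matI)
        fix i j
        assume "i < dim_row (mat_add T (scaled_unit T \<epsilon> p) (map_mat \<phi> h))"
          and "j < dim_col (mat_add T (scaled_unit T \<epsilon> p) (map_mat \<phi> h))"
        then have ij: "i < p" "j < p" by (auto simp: mat_add_def scaled_unit_def)
        have u: "scaled_unit R \<epsilon> p $$ (i, j) \<in> carrier R" using matsD(4)[OF unit_mat] ij by blast
        have "\<phi> (scaled_unit R \<epsilon> p $$ (i, j)) = scaled_unit T \<epsilon> p $$ (i, j)"
          using ij by (simp add: scaled_unit_def \<phi>_smult \<phi>_zero R.unit_closed unit)
        moreover have "\<phi> (k $$ (i, j)) = \<zero>\<^bsub>T\<^esub>" "k $$ (i, j) \<in> carrier R"
          using kd(2)[OF ij] by (auto simp: J_iff)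
        ultimately have "\<phi> (scaled_unit R \<epsilon> p $$ (i, j) \<oplus>\<^bsub>R\<^esub> h $$ (i, j) \<oplus>\<^bsub>R\<^esub> k $$ (i, j))
            = scaled_unit T \<epsilon> p $$ (i, j) \<oplus>\<^bsub>T\<^esub> \<phi> (h $$ (i, j))"
          using u hd(4)[OF ij] \<phi>_closed[OF u] by (simp add: \<phi>_add \<phi>_closed)
        then show "map_mat \<phi> (mat_add R (mat_add R (scaled_unit R \<epsilon> p) h) k) $$ (i, j)
            = mat_add T (scaled_unit T \<epsilon> p) (map_mat \<phi> h) $$ (i, j)"
          using ij hd(2,3) by (simp add: mat_add_def matsD(2,3)[OF unit_mat])
             (simp add: scaled_unit_def)
      qed (auto simp: mat_add_def scaled_unit_def)
      ultimately show "mat_add T (scaled_unit T \<epsilon> p) (map_mat \<phi> h) \<in> cone T p" by simp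
    qed
    ultimately show "map_mat \<psi> X \<in> cone T p" by simp
  qed
  moreover have "cp_map T Q (inv_into (carrier Q) \<psi>)"
    unfolding cp_map_def
  proof (intro conjI allI impI ballI)
    \<comment> \<open>Every element of \<open>T\<close> is some \<open>\<phi> x\<close>, where the
      inverse takes the value \<open>\<pi> x\<close>; linearity follows by collecting sums and
      multiples under \<open>\<phi>\<close>.\<close>
    show "inv_into (carrier Q) \<psi> \<in> LinearCombinations.module_hom class_ring T Q"
      unfolding LinearCombinations.module_hom_def surj[symmetric]
      by (auto simp: Qsimps(1) inv[unfolded Qsimps(1)] \<pi>_add \<pi>_smult smultR simp flip: \<phi>_add \<phi>_smult)
  next
    fix p :: nat and B
    assume p: "0 < p" and "B \<in> cone T p"
    then obtain A where A: "A \<in> cone R p" and B: "B = map_mat \<phi> A" using lift by blast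
    have As: "A \<in> sa_mats R (carrier R) p" using R.cone_selfadjoint[OF p] A by blast
    then have Am: "A \<in> mats (carrier R) p" by (simp add: sa_mats_def)
    note Ad = matsD[OF Am]
    have "map_mat (inv_into (carrier Q) \<psi>) B = map_mat \<pi> A"
      unfolding B by (rule eq_matI) (use Ad in \<open>auto simp: inv\<close>)
    moreover have "\<exists>k\<in>sa_mats R J p. mat_add R (mat_add R (scaled_unit R \<epsilon> p) A) k \<in> cone R p"
      if "0 < \<epsilon>" for \<epsilon>
    proof
      let ?k = "mat p p (\<lambda>_. \<zero>\<^bsub>R\<^esub>)"
      \<comment> \<open>That the zero matrix is selfadjoint comes from conjugate homogeneity at the
        scalar 0.\<close>
      have "star R \<zero>\<^bsub>R\<^esub> = star R ((0 :: complex) \<odot>\<^bsub>R\<^esub> \<zero>\<^bsub>R\<^esub>)"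
        using R.smult_r_null[of 0] by (simp add: class_ring_simps)
      also have "\<dots> = cnj 0 \<odot>\<^bsub>R\<^esub> star R \<zero>\<^bsub>R\<^esub>" by (rule R.star_smult) simp
      also have "\<dots> = \<zero>\<^bsub>R\<^esub>"
        using R.smult_l_null[of "star R \<zero>\<^bsub>R\<^esub>"] R.star_closed by (simp add: class_ring_simps)
      finally show "?k \<in> sa_mats R J p"
        using J_zero by (auto simp: sa_mats_def mats_def mat_star_def intro!: eq_matI)
      have "mat_add R (mat_add R (scaled_unit R \<epsilon> p) A) ?k = mat_add R (scaled_unit R \<epsilon> p) A"
        by (rule eq_matI)
           (use matsD[OF unit_mat] Ad in \<open>auto simp: mat_add_def\<close>)
      then show "mat_add R (mat_add R (scaled_unit R \<epsilon> p) A) ?k \<in> cone R p"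
        using R.cone_add[OF p unit_pos[OF p that] A] by simp
    qed
    ultimately show "map_mat (inv_into (carrier Q) \<psi>) B \<in> cone Q p"
      unfolding Qsimps using As by blast
  qed
  ultimately have "complete_order_iso Q T \<psi>"
    unfolding complete_order_iso_def using bij by blast
  then show ?thesis
    unfolding complete_quotient_map_def using R T cp by (simp add: Q_def J_def \<psi>_def)
qed

section \<open>The Toeplitz operator system\<close>

definition block_kernel :: "complex mat mat \<Rightarrow> nat \<times> nat \<Rightarrow> nat \<times> nat \<Rightarrow> complex" where
  "block_kernel A x y = A $$ (fst x, fst y) $$ (snd x, snd y)"

lemma dim_mat_adjoint [simp]:
  "dim_row (mat_adjoint A) = dim_col A" "dim_col (mat_adjoint A) = dim_row A"
  by (simp_all add: mat_adjoint_def)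

lemma index_mat_adjoint:
  fixes A :: "complex mat"
  assumes "i < dim_col A" "j < dim_row A"
  shows "mat_adjoint A $$ (i, j) = cnj (A $$ (j, i))"
  using assms by (simp add: mat_adjoint_def mat_of_rows_index)

lemma psd_iff_psd_on:
  assumes M: "M \<in> carrier_mat N N"
  shows "psd M \<longleftrightarrow> psd_on {..<N} (\<lambda>i j. M $$ (i, j))"
proof -
  have d: "dim_row M = N" "dim_col M = N" using M by auto
  have "mat_adjoint M = M \<longleftrightarrow> (\<forall>i<N. \<forall>j<N. cnj (M $$ (i, j)) = M $$ (j, i))"
    unfolding mat_eq_iff by (auto simp: d index_mat_adjoint)
  moreover have "(M *\<^sub>v v) \<bullet>c v = sesq {..<N} (\<lambda>i j. M $$ (i, j)) (($) v) (($) v)"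
    if "v \<in> carrier_vec N" for v
    unfolding sesq_left using that d
    by (auto simp: scalar_prod_def atLeast0LessThan mult.commute intro!: sum.cong)
  moreover have "sesq {..<N} (\<lambda>i j. M $$ (i, j)) f f
      = sesq {..<N} (\<lambda>i j. M $$ (i, j)) (($) (vec N f)) (($) (vec N f))" for f
    by (rule sesq_cong) auto
  ultimately show ?thesis
    unfolding psd_def psd_on_def d by (metis lessThan_iff vec_carrier)
qed

text \<open>Division with remainder by \<open>n\<close> is a bijection from the flattened indices to
  pairs, both sets being empty for \<open>n = 0\<close>. From here on positivity is handled on pairs
  only.\<close>

lemma psd_block_mat:
  assumes A: "A \<in> mats (carrier_mat n n) p"
  shows "psd (block_mat n A) \<longleftrightarrow> psd_on ({..<p} \<times> {..<n}) (block_kernel A)"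
proof -
  let ?h = "\<lambda>r. (r div n, r mod n)"
  have inj: "inj_on ?h {..<p * n}"
    by (rule inj_onI) (metis div_mult_mod_eq prod.inject)
  have im: "?h ` {..<p * n} = {..<p} \<times> {..<n}"
  proof (intro equalityI subsetI)
    fix x assume "x \<in> ?h ` {..<p * n}"
    then show "x \<in> {..<p} \<times> {..<n}"
      by (auto simp: less_mult_imp_div_less intro!: mod_less_divisor gr0I)
  next
    fix x assume "x \<in> {..<p} \<times> {..<n}"
    then obtain a i where x: "x = (a, i)" "a < p" "i < n" by auto
    have "a * n + i < Suc a * n" using x by simp
    also have "\<dots> \<le> p * n" using x by (intro mult_le_mono1) simp
    finally show "x \<in> ?h ` {..<p * n}"
      using x by (intro image_eqI[of _ _ "a * n + i"]) auto
  qed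
  have "block_mat n A \<in> carrier_mat (p * n) (p * n)"
    using A by (auto simp: block_mat_def mats_def)
  then have "psd (block_mat n A) \<longleftrightarrow> psd_on {..<p * n} (\<lambda>i j. block_mat n A $$ (i, j))"
    by (rule psd_iff_psd_on)
  also have "\<dots> \<longleftrightarrow> psd_on {..<p * n} (\<lambda>i j. block_kernel A (?h i) (?h j))"
    by (rule psd_on_cong) (use A in \<open>auto simp: block_mat_def mats_def block_kernel_def\<close>)
  also have "\<dots> \<longleftrightarrow> psd_on ({..<p} \<times> {..<n}) (block_kernel A)"
    using psd_on_reindex[OF inj, of "block_kernel A"] im by simp
  finally show ?thesis .
qed

section \<open>Closure properties of Toeplitz matrices\<close>

lemma toeplitz_matsI:
  assumes "A \<in> carrier_mat n n" "\<And>i j. i < n \<Longrightarrow> j < n \<Longrightarrow> A $$ (i, j) = \<tau> (int i - int j)"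
  shows "A \<in> toeplitz_mats n"
  unfolding toeplitz_mats_def using assms by (auto simp: mat_eq_iff)

lemma toeplitz_matsE:
  assumes "A \<in> toeplitz_mats n"
  obtains \<tau> where "A \<in> carrier_mat n n"
    "\<And>i j. i < n \<Longrightarrow> j < n \<Longrightarrow> A $$ (i, j) = \<tau> (int i - int j)"
  using assms unfolding toeplitz_mats_def by fastforce

lemma toeplitz_mats_carrier: "A \<in> toeplitz_mats n \<Longrightarrow> A \<in> carrier_mat n n"
  by (auto elim: toeplitz_matsE)

lemma toeplitz_mats_add:
  assumes "A \<in> toeplitz_mats n" "B \<in> toeplitz_mats n"
  shows "A + B \<in> toeplitz_mats n"
proof -
  obtain \<sigma> where "A \<in> carrier_mat n n"
    "\<And>i j. i < n \<Longrightarrow> j < n \<Longrightarrow> A $$ (i, j) = \<sigma> (int i - int j)"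
    by (rule toeplitz_matsE[OF assms(1)]) blast
  moreover obtain \<tau> where "B \<in> carrier_mat n n"
    "\<And>i j. i < n \<Longrightarrow> j < n \<Longrightarrow> B $$ (i, j) = \<tau> (int i - int j)"
    by (rule toeplitz_matsE[OF assms(2)]) blast
  ultimately show ?thesis by (intro toeplitz_matsI[of _ _ "\<lambda>k. \<sigma> k + \<tau> k"]) auto
qed

lemma toeplitz_mats_smult:
  assumes "A \<in> toeplitz_mats n"
  shows "c \<cdot>\<^sub>m A \<in> toeplitz_mats n"
proof -
  obtain \<tau> where "A \<in> carrier_mat n n"
    "\<And>i j. i < n \<Longrightarrow> j < n \<Longrightarrow> A $$ (i, j) = \<tau> (int i - int j)"
    by (rule toeplitz_matsE[OF assms]) blast
  then show ?thesis by (intro toeplitz_matsI[of _ _ "\<lambda>k. c * \<tau> k"]) auto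
qed

lemma toeplitz_mats_uminus:
  assumes "A \<in> toeplitz_mats n"
  shows "- A \<in> toeplitz_mats n"
proof -
  obtain \<tau> where "A \<in> carrier_mat n n"
    "\<And>i j. i < n \<Longrightarrow> j < n \<Longrightarrow> A $$ (i, j) = \<tau> (int i - int j)"
    by (rule toeplitz_matsE[OF assms]) blast
  then show ?thesis by (intro toeplitz_matsI[of _ _ "\<lambda>k. - \<tau> k"]) auto
qed

lemma toeplitz_mats_adjoint:
  assumes "A \<in> toeplitz_mats n"
  shows "mat_adjoint A \<in> toeplitz_mats n"
proof -
  obtain \<tau> where "A \<in> carrier_mat n n"
    "\<And>i j. i < n \<Longrightarrow> j < n \<Longrightarrow> A $$ (i, j) = \<tau> (int i - int j)"
    by (rule toeplitz_matsE[OF assms]) blast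
  then show ?thesis
    by (intro toeplitz_matsI[of _ _ "\<lambda>k. cnj (\<tau> (- k))"] carrier_matI) (auto simp: index_mat_adjoint)
qed

lemma toeplitz_mats_zero: "0\<^sub>m n n \<in> toeplitz_mats n"
  by (rule toeplitz_matsI[of _ _ "\<lambda>_. 0"]) auto

lemma toeplitz_mats_one: "1\<^sub>m n \<in> toeplitz_mats n"
  by (rule toeplitz_matsI[of _ _ "\<lambda>k. if k = 0 then 1 else 0"]) auto

section \<open>The abstract operations of the Toeplitz system in terms of entries\<close>

lemma toeplitz_opsys_simps:
  "carrier (toeplitz_opsys n) = toeplitz_mats n"
  "add (toeplitz_opsys n) = (+)"
  "zero (toeplitz_opsys n) = 0\<^sub>m n n"
  "module.smult (toeplitz_opsys n) = (\<cdot>\<^sub>m)"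
  "star (toeplitz_opsys n) = mat_adjoint"
  "ounit (toeplitz_opsys n) = 1\<^sub>m n"
  by (simp_all add: toeplitz_opsys_def subsystem_def matrix_opsys_def module.extend_def module_mat_def)

lemma mem_cone_toeplitz_opsys:
  "A \<in> cone (toeplitz_opsys n) p \<longleftrightarrow>
    A \<in> mats (toeplitz_mats n) p \<and> psd_on ({..<p} \<times> {..<n}) (block_kernel A)"
proof -
  have "A \<in> mats (carrier_mat n n) p" if "A \<in> mats (toeplitz_mats n) p"
    using that toeplitz_mats_carrier by (auto simp: mats_def)
  then show ?thesis
    by (auto simp: toeplitz_opsys_def subsystem_def matrix_opsys_def module.extend_def psd_block_mat)
qed

lemma toeplitz_opsys_vectorspace: "vectorspace class_ring (toeplitz_opsys n)"
proof -
  have "\<exists>y\<in>toeplitz_mats n. y + x = 0\<^sub>m n n" if "x \<in> toeplitz_mats n" for x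
    using that toeplitz_mats_carrier[OF that]
    by (intro bexI[of _ "- x"] toeplitz_mats_uminus) auto
  then have "abelian_group (toeplitz_opsys n)"
    by (intro abelian_groupI)
       (auto simp: toeplitz_opsys_simps toeplitz_mats_add toeplitz_mats_zero
         dest!: toeplitz_mats_carrier intro: comm_add_mat)
  then have "Module.module class_ring (toeplitz_opsys n)"
    using class_field[where ?'a = complex]
    by (intro moduleI)
       (auto simp: toeplitz_opsys_simps class_ring_simps toeplitz_mats_smult field_def domain_def
         dest!: toeplitz_mats_carrier intro: add_smult_distrib_left_mat add_smult_distrib_right_mat)
  then show ?thesis
    using class_field by (rule vectorspace.intro)
qed

lemma toeplitz_opsys_a_inv:
  assumes "x \<in> toeplitz_mats n"
  shows "\<ominus>\<^bsub>toeplitz_opsys n\<^esub> x = - x"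
proof -
  interpret vectorspace class_ring "toeplitz_opsys n" by (rule toeplitz_opsys_vectorspace)
  show ?thesis
    by (rule M.minus_equality)
       (use assms toeplitz_mats_carrier[OF assms] in \<open>auto simp: toeplitz_opsys_simps toeplitz_mats_uminus\<close>)
qed

lemma toeplitz_opsys_finsum:
  assumes "finite F" "\<And>k. k \<in> F \<Longrightarrow> f k \<in> toeplitz_mats n"
  shows "finsum (toeplitz_opsys n) f F \<in> toeplitz_mats n"
    and "i < n \<Longrightarrow> j < n \<Longrightarrow> finsum (toeplitz_opsys n) f F $$ (i, j) = (\<Sum>k\<in>F. f k $$ (i, j))"
proof -
  interpret vectorspace class_ring "toeplitz_opsys n" by (rule toeplitz_opsys_vectorspace)
  have closed: "finsum (toeplitz_opsys n) f G \<in> toeplitz_mats n" if "G \<subseteq> F" for G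
    using M.finsum_closed[of f G] that assms(2) by (auto simp: toeplitz_opsys_simps)
  then show "finsum (toeplitz_opsys n) f F \<in> toeplitz_mats n" by blast
  assume ij: "i < n" "j < n"
  \<comment> \<open>The induction runs over subsets of \<open>F\<close> because \<open>f\<close> is
    known to take values in the carrier only there.\<close>
  have "G \<subseteq> F \<longrightarrow> finsum (toeplitz_opsys n) f G $$ (i, j) = (\<Sum>k\<in>G. f k $$ (i, j))" if "finite G" for G
    using that
  proof (induction G rule: finite_induct)
    case empty
    show ?case using ij by (simp add: toeplitz_opsys_simps)
  next
    case (insert k G)
    show ?case
    proof
      assume sub: "insert k G \<subseteq> F"
      then have "f \<in> G \<rightarrow> carrier (toeplitz_opsys n)" "f k \<in> carrier (toeplitz_opsys n)"
        using assms(2) by (auto simp: toeplitz_opsys_simps)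
      then have "finsum (toeplitz_opsys n) f (insert k G) = f k + finsum (toeplitz_opsys n) f G"
        using M.finsum_insert[OF insert.hyps] by (simp add: toeplitz_opsys_simps)
      moreover have "finsum (toeplitz_opsys n) f G \<in> carrier_mat n n"
        using closed[of G] sub toeplitz_mats_carrier by blast
      ultimately show "finsum (toeplitz_opsys n) f (insert k G) $$ (i, j) = (\<Sum>k\<in>insert k G. f k $$ (i, j))"
        using insert sub ij by auto
    qed
  qed
  then show "finsum (toeplitz_opsys n) f F $$ (i, j) = (\<Sum>k\<in>F. f k $$ (i, j))"
    using assms(1) by blast
qed

text \<open>Replaces the nested algebraic sums in \<open>compress\<close> by ordinary double sums of
  entries, which can be compared with \<open>sesq\<close>.\<close>

lemma toeplitz_opsys_compress:
  assumes A: "A \<in> mats (toeplitz_mats n) p" and X: "X \<in> carrier_mat q p"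
  shows "compress (toeplitz_opsys n) X A \<in> mats (toeplitz_mats n) q"
    and "\<lbrakk>a < q; b < q; i < n; j < n\<rbrakk> \<Longrightarrow> compress (toeplitz_opsys n) X A $$ (a, b) $$ (i, j) =
      (\<Sum>k<p. \<Sum>l<p. X $$ (a, k) * cnj (X $$ (b, l)) * A $$ (k, l) $$ (i, j))"
proof -
  have Xd: "dim_row X = q" "dim_col X = p" using X by auto
  define s where "s = (\<lambda>a b k l. (X $$ (a, k) * cnj (X $$ (b, l))) \<cdot>\<^sub>m A $$ (k, l))"
  have s: "s a b k l \<in> toeplitz_mats n" if "k < p" "l < p" for a b k l
    unfolding s_def using matsD(4)[OF A] that by (intro toeplitz_mats_smult) auto
  have s1: "(\<Oplus>\<^bsub>toeplitz_opsys n\<^esub>l\<in>{..<p}. s a b k l) \<in> toeplitz_mats n" if "k < p" for a b k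
    using s that by (intro toeplitz_opsys_finsum) auto
  have c: "compress (toeplitz_opsys n) X A = mat q q (\<lambda>(a, b).
      \<Oplus>\<^bsub>toeplitz_opsys n\<^esub>k\<in>{..<p}. \<Oplus>\<^bsub>toeplitz_opsys n\<^esub>l\<in>{..<p}. s a b k l)"
    by (simp add: compress_def Xd s_def toeplitz_opsys_simps)
  show "compress (toeplitz_opsys n) X A \<in> mats (toeplitz_mats n) q"
    unfolding c mats_def using s by (auto intro!: toeplitz_opsys_finsum(1))
  assume ab: "a < q" "b < q" and ij: "i < n" "j < n"
  have "(\<Oplus>\<^bsub>toeplitz_opsys n\<^esub>k\<in>{..<p}. \<Oplus>\<^bsub>toeplitz_opsys n\<^esub>l\<in>{..<p}. s a b k l) $$ (i, j)
      = (\<Sum>k<p. (\<Oplus>\<^bsub>toeplitz_opsys n\<^esub>l\<in>{..<p}. s a b k l) $$ (i, j))"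
    using s1 ij by (intro toeplitz_opsys_finsum(2)) auto
  also have "\<dots> = (\<Sum>k<p. \<Sum>l<p. s a b k l $$ (i, j))"
    using s ij by (intro sum.cong refl toeplitz_opsys_finsum(2)) auto
  also have "\<dots> = (\<Sum>k<p. \<Sum>l<p. X $$ (a, k) * cnj (X $$ (b, l)) * A $$ (k, l) $$ (i, j))"
  proof (intro sum.cong refl)
    fix k l assume "k \<in> {..<p}" "l \<in> {..<p}"
    then have "A $$ (k, l) \<in> carrier_mat n n" using matsD(4)[OF A] toeplitz_mats_carrier by auto
    then show "s a b k l $$ (i, j) = X $$ (a, k) * cnj (X $$ (b, l)) * A $$ (k, l) $$ (i, j)"
      using ij by (simp add: s_def)
  qed
  finally show "compress (toeplitz_opsys n) X A $$ (a, b) $$ (i, j) =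
      (\<Sum>k<p. \<Sum>l<p. X $$ (a, k) * cnj (X $$ (b, l)) * A $$ (k, l) $$ (i, j))"
    using ab by (simp add: c)
qed

lemma sa_mats_toeplitz_opsys:
  "A \<in> sa_mats (toeplitz_opsys n) (toeplitz_mats n) p \<longleftrightarrow> A \<in> mats (toeplitz_mats n) p \<and>
    (\<forall>x\<in>{..<p} \<times> {..<n}. \<forall>y\<in>{..<p} \<times> {..<n}. cnj (block_kernel A x y) = block_kernel A y x)"
proof -
  have "mat_star (toeplitz_opsys n) A = A \<longleftrightarrow>
      (\<forall>x\<in>{..<p} \<times> {..<n}. \<forall>y\<in>{..<p} \<times> {..<n}. cnj (block_kernel A x y) = block_kernel A y x)"
    if A: "A \<in> mats (toeplitz_mats n) p"
  proof -
    note d = matsD(2,3)[OF A]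
    have dn: "dim_row (A $$ (a, b)) = n" "dim_col (A $$ (a, b)) = n" if "a < p" "b < p" for a b
      using toeplitz_mats_carrier[OF matsD(4)[OF A that]] by auto
    have "mat_star (toeplitz_opsys n) A = A \<longleftrightarrow>
        (\<forall>a<p. \<forall>b<p. mat_adjoint (A $$ (b, a)) = A $$ (a, b))"
      unfolding mat_eq_iff[of "mat_star _ _"] by (auto simp: mat_star_def d toeplitz_opsys_simps)
    also have "\<dots> \<longleftrightarrow> (\<forall>a<p. \<forall>b<p. \<forall>i<n. \<forall>j<n. cnj (A $$ (b, a) $$ (j, i)) = A $$ (a, b) $$ (i, j))"
      unfolding mat_eq_iff[of "mat_adjoint _"] by (auto simp: dn index_mat_adjoint)
    also have "\<dots> \<longleftrightarrow>
        (\<forall>x\<in>{..<p} \<times> {..<n}. \<forall>y\<in>{..<p} \<times> {..<n}. cnj (block_kernel A x y) = block_kernel A y x)"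
      by (auto simp: block_kernel_def)
    finally show ?thesis .
  qed
  then show ?thesis by (auto simp: sa_mats_def)
qed

lemma scaled_unit_toeplitz_opsys:
  "scaled_unit (toeplitz_opsys n) r p \<in> mats (toeplitz_mats n) p"
  "\<lbrakk>x \<in> {..<p} \<times> {..<n}; y \<in> {..<p} \<times> {..<n}\<rbrakk> \<Longrightarrow>
    block_kernel (scaled_unit (toeplitz_opsys n) r p) x y = (if x = y then of_real r else 0)"
proof -
  show "scaled_unit (toeplitz_opsys n) r p \<in> mats (toeplitz_mats n) p"
    by (simp add: scaled_unit_def mats_def toeplitz_opsys_simps
        toeplitz_mats_smult toeplitz_mats_one toeplitz_mats_zero)
  assume "x \<in> {..<p} \<times> {..<n}" "y \<in> {..<p} \<times> {..<n}"
  then show "block_kernel (scaled_unit (toeplitz_opsys n) r p) x y = (if x = y then of_real r else 0)"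
    by (cases "fst x = fst y")
       (auto simp: scaled_unit_def block_kernel_def toeplitz_opsys_simps split: if_splits)
qed

lemma mat_add_toeplitz_opsys:
  assumes A: "A \<in> mats (toeplitz_mats n) p" and B: "B \<in> mats (toeplitz_mats n) p"
  shows "mat_add (toeplitz_opsys n) A B \<in> mats (toeplitz_mats n) p"
    and "\<lbrakk>x \<in> {..<p} \<times> {..<n}; y \<in> {..<p} \<times> {..<n}\<rbrakk> \<Longrightarrow>
      block_kernel (mat_add (toeplitz_opsys n) A B) x y = block_kernel A x y + block_kernel B x y"
proof -
  show "mat_add (toeplitz_opsys n) A B \<in> mats (toeplitz_mats n) p"
    using matsD[OF A] matsD[OF B]
    by (auto simp: mats_def mat_add_def toeplitz_opsys_simps toeplitz_mats_add)
  assume xy: "x \<in> {..<p} \<times> {..<n}" "y \<in> {..<p} \<times> {..<n}"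
  then have "B $$ (fst x, fst y) \<in> carrier_mat n n"
    using matsD(4)[OF B] toeplitz_mats_carrier by auto
  then show "block_kernel (mat_add (toeplitz_opsys n) A B) x y = block_kernel A x y + block_kernel B x y"
    using xy matsD(2,3)[OF A] by (auto simp: mat_add_def block_kernel_def toeplitz_opsys_simps)
qed

lemma scaled_unit_add_in_cone_toeplitz:
  assumes "A \<in> mats (toeplitz_mats n) p"
  shows "mat_add (toeplitz_opsys n) (scaled_unit (toeplitz_opsys n) r p) A \<in> cone (toeplitz_opsys n) p
    \<longleftrightarrow> psd_on ({..<p} \<times> {..<n}) (\<lambda>x y. (if x = y then of_real r else 0) + block_kernel A x y)"
  unfolding mem_cone_toeplitz_opsys
  using mat_add_toeplitz_opsys[OF scaled_unit_toeplitz_opsys(1) assms]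
  by (auto simp: scaled_unit_toeplitz_opsys cong: psd_on_cong)

lemma operator_system_toeplitz: "operator_system (toeplitz_opsys n)"
proof -
  let ?V = "toeplitz_opsys n"
  let ?S = "\<lambda>p. {..<p} \<times> {..<n}"
  interpret vectorspace class_ring ?V by (rule toeplitz_opsys_vectorspace)
  show ?thesis
  proof
    fix x assume "x \<in> carrier ?V"
    then show "star ?V x \<in> carrier ?V"
      by (simp add: toeplitz_opsys_simps toeplitz_mats_adjoint)
  next
    fix x assume "x \<in> carrier ?V"
    then show "star ?V (star ?V x) = x"
      by (intro eq_matI) (auto simp: toeplitz_opsys_simps index_mat_adjoint)
  next
    fix x y assume "x \<in> carrier ?V" "y \<in> carrier ?V"
    then have "x \<in> carrier_mat n n" "y \<in> carrier_mat n n"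
      by (simp_all add: toeplitz_opsys_simps toeplitz_mats_carrier)
    then show "star ?V (x \<oplus>\<^bsub>?V\<^esub> y) = star ?V x \<oplus>\<^bsub>?V\<^esub> star ?V y"
      by (intro eq_matI) (auto simp: toeplitz_opsys_simps index_mat_adjoint)
  next
    fix x c
    show "star ?V (c \<odot>\<^bsub>?V\<^esub> x) = cnj c \<odot>\<^bsub>?V\<^esub> star ?V x"
      by (intro eq_matI) (auto simp: toeplitz_opsys_simps index_mat_adjoint)
  next
    show "ounit ?V \<in> carrier ?V" by (simp add: toeplitz_opsys_simps toeplitz_mats_one)
    show "star ?V (ounit ?V) = ounit ?V"
      by (intro eq_matI) (auto simp: toeplitz_opsys_simps index_mat_adjoint)
  next
    fix p
    show "cone ?V p \<subseteq> sa_mats ?V (carrier ?V) p"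
      unfolding toeplitz_opsys_simps
      by (rule subsetI, unfold sa_mats_toeplitz_opsys mem_cone_toeplitz_opsys)
         (blast intro: psd_on_hermitian[where K = "block_kernel A" for A])
  next
    fix p A B assume "A \<in> cone ?V p" "B \<in> cone ?V p"
    then show "mat_add ?V A B \<in> cone ?V p"
      using mat_add_toeplitz_opsys[of A n p B] psd_on_add[of "?S p" "block_kernel A" "block_kernel B"]
        psd_on_cong[of "?S p" "block_kernel (mat_add ?V A B)" "\<lambda>x y. block_kernel A x y + block_kernel B x y"]
      by (simp add: mem_cone_toeplitz_opsys)
  next
    fix p q A and X :: "complex mat"
    assume "A \<in> cone ?V p" and X: "X \<in> carrier_mat q p"
    then have A: "A \<in> mats (toeplitz_mats n) p" and psd: "psd_on (?S p) (block_kernel A)"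
      by (auto simp: mem_cone_toeplitz_opsys)
    \<comment> \<open>Compression by \<open>X\<close> is conjugation of the flattened matrix by the
      tensor product of \<open>X\<close> with the identity of size \<open>n\<close>.
      \<open>F x\<close> is the conjugate of row \<open>x\<close> of that product, so that the left
      slot of \<open>sesq\<close> restores the entries of \<open>X\<close>.\<close>
    define F :: "nat \<times> nat \<Rightarrow> nat \<times> nat \<Rightarrow> complex"
      where "F = (\<lambda>x z. if snd x = snd z then cnj (X $$ (fst x, fst z)) else 0)"
    have "block_kernel (compress ?V X A) x y = sesq (?S p) (block_kernel A) (F x) (F y)"
      if xy: "x \<in> ?S q" "y \<in> ?S q" for x y
    proof -
      obtain a i b j where [simp]: "x = (a, i)" "y = (b, j)" by (metis surj_pair)
      have ij: "a < q" "b < q" "i < n" "j < n" using xy by auto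
      \<comment> \<open>The Kronecker delta in the position reduces a sum over pairs to a sum over
        block indices.\<close>
      have slice: "(\<Sum>z\<in>?S p. if l = snd z then h z else 0) = (\<Sum>k<p. h (k, l))"
        if "l < n" for l and h :: "nat \<times> nat \<Rightarrow> complex"
        using that by (simp add: sum.cartesian_product' cong: if_cong)
      have right: "(\<Sum>z\<in>?S p. g z * F (b, j) z) = (\<Sum>l<p. g (l, j) * cnj (X $$ (b, l)))" for g
        using slice[OF ij(4), of "\<lambda>z. g z * cnj (X $$ (b, fst z))"]
        by (simp add: F_def if_distrib[of "\<lambda>c. t * c" for t] cong: if_cong)
      have left: "(\<Sum>z\<in>?S p. cnj (F (a, i) z) * g z) = (\<Sum>k<p. X $$ (a, k) * g (k, i))" for g
        using slice[OF ij(3), of "\<lambda>z. X $$ (a, fst z) * g z"]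
        by (simp add: F_def if_distrib[of cnj] if_distrib[of "\<lambda>c. c * t" for t] cong: if_cong)
      have "sesq (?S p) (block_kernel A) (F x) (F y)
          = (\<Sum>k<p. X $$ (a, k) * (\<Sum>l<p. block_kernel A (k, i) (l, j) * cnj (X $$ (b, l))))"
        unfolding sesq_left by (simp add: left right)
      also have "\<dots> = (\<Sum>k<p. \<Sum>l<p. X $$ (a, k) * cnj (X $$ (b, l)) * A $$ (k, l) $$ (i, j))"
        by (simp add: sum_distrib_left block_kernel_def mult_ac)
      finally show ?thesis
        using toeplitz_opsys_compress(2)[OF A X ij] by (simp add: block_kernel_def)
    qed
    then show "compress ?V X A \<in> cone ?V q"
      using toeplitz_opsys_compress(1)[OF A X] psd_on_congruence[OF psd, of "?S q" F]
        psd_on_cong[of "?S q" "block_kernel (compress ?V X A)"]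
      by (simp add: mem_cone_toeplitz_opsys)
  next
    fix p A assume "A \<in> cone ?V p" and neg: "map_mat (\<lambda>x. \<ominus>\<^bsub>?V\<^esub> x) A \<in> cone ?V p"
    then have A: "A \<in> mats (toeplitz_mats n) p" and psd: "psd_on (?S p) (block_kernel A)"
      by (auto simp: mem_cone_toeplitz_opsys)
    have Ac: "A $$ (a, b) \<in> carrier_mat n n" if "a < p" "b < p" for a b
      using toeplitz_mats_carrier matsD(4)[OF A that] by blast
    have "block_kernel (map_mat (\<lambda>x. \<ominus>\<^bsub>?V\<^esub> x) A) x y = - block_kernel A x y"
      if "x \<in> ?S p" "y \<in> ?S p" for x y
      using that Ac[of "fst x" "fst y"] matsD[OF A]
      by (auto simp: block_kernel_def toeplitz_opsys_a_inv)
    then have "psd_on (?S p) (\<lambda>x y. - block_kernel A x y)"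
      using neg psd_on_cong[of "?S p" "block_kernel (map_mat (\<lambda>x. \<ominus>\<^bsub>?V\<^esub> x) A)"
        "\<lambda>x y. - block_kernel A x y"]
      by (simp add: mem_cone_toeplitz_opsys)
    then have zero: "block_kernel A x y = 0" if "x \<in> ?S p" "y \<in> ?S p" for x y
      using psd_on_proper[OF _ psd] that by blast
    have "A $$ (a, b) = 0\<^sub>m n n" if "a < p" "b < p" for a b
    proof (rule eq_matI)
      fix i j assume "i < dim_row (0\<^sub>m n n)" "j < dim_col (0\<^sub>m n n)"
      then show "A $$ (a, b) $$ (i, j) = 0\<^sub>m n n $$ (i, j)"
        using zero[of "(a, i)" "(b, j)"] that by (simp add: block_kernel_def)
    qed (use Ac[OF that] in auto)
    then show "A = mat p p (\<lambda>_. \<zero>\<^bsub>?V\<^esub>)"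
      by (intro eq_matI) (use matsD[OF A] in \<open>auto simp: toeplitz_opsys_simps\<close>)
  next
    fix p A assume "A \<in> sa_mats ?V (carrier ?V) p"
    then have A: "A \<in> mats (toeplitz_mats n) p"
      and herm: "\<And>x y. x \<in> ?S p \<Longrightarrow> y \<in> ?S p \<Longrightarrow> cnj (block_kernel A x y) = block_kernel A y x"
      unfolding toeplitz_opsys_simps sa_mats_toeplitz_opsys by blast+
    show "\<exists>r>0. mat_add ?V (scaled_unit ?V r p) A \<in> cone ?V p"
      unfolding scaled_unit_add_in_cone_toeplitz[OF A]
      by (rule hermitian_order_unit[OF _ herm]) auto
  next
    fix p A assume "A \<in> sa_mats ?V (carrier ?V) p"
      and pos: "\<And>\<epsilon>. 0 < \<epsilon> \<Longrightarrow> mat_add ?V (scaled_unit ?V \<epsilon> p) A \<in> cone ?V p"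
    then have A: "A \<in> mats (toeplitz_mats n) p"
      and herm: "\<And>x y. x \<in> ?S p \<Longrightarrow> y \<in> ?S p \<Longrightarrow> cnj (block_kernel A x y) = block_kernel A y x"
      unfolding toeplitz_opsys_simps sa_mats_toeplitz_opsys by blast+
    have "psd_on (?S p) (block_kernel A)"
      by (rule psd_on_archimedean[OF _ herm pos[unfolded scaled_unit_add_in_cone_toeplitz[OF A]]]) auto
    then show "A \<in> cone ?V p"
      using A by (simp add: mem_cone_toeplitz_opsys)
  qed
qed

section \<open>Truncation to the upper left corner as a complete quotient map\<close>

theorem theorem1p14:
  fixes m n :: nat
  assumes "m \<ge> n" and "n \<ge> 2"
  shows "is_operator_system_quotient_of (toeplitz_opsys n) (toeplitz_opsys m)"
proof -
  define \<phi> :: "complex mat \<Rightarrow> complex mat" where "\<phi> = (\<lambda>A. mat n n (\<lambda>ij. A $$ ij))"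
  have ind: "\<phi> A $$ (i, j) = A $$ (i, j)" if "i < n" "j < n" for A i j
    using that by (simp add: \<phi>_def)
  have dim: "dim_row (\<phi> A) = n" "dim_col (\<phi> A) = n" "\<phi> A \<in> carrier_mat n n" for A
    by (simp_all add: \<phi>_def)
  have closed: "\<phi> A \<in> toeplitz_mats n" if A: "A \<in> toeplitz_mats m" for A
  proof -
    obtain \<tau> where "\<And>i j. i < m \<Longrightarrow> j < m \<Longrightarrow> A $$ (i, j) = \<tau> (int i - int j)"
      by (rule toeplitz_matsE[OF A]) blast
    then show ?thesis
      using assms(1) by (intro toeplitz_matsI[of _ _ \<tau>]) (auto simp: ind dim)
  qed
  have mats: "map_mat \<phi> A \<in> mats (toeplitz_mats n) p" if "A \<in> mats (toeplitz_mats m) p" for A p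
    using matsD[OF that] closed by (auto simp: mats_def)
  have kernel: "block_kernel (map_mat \<phi> A) x y = block_kernel A x y"
    if "A \<in> mats (toeplitz_mats m) p" "x \<in> {..<p} \<times> {..<n}" "y \<in> {..<p} \<times> {..<n}" for A p x y
    using matsD[OF that(1)] that(2,3) by (auto simp: block_kernel_def ind)
  have sub: "{..<p} \<times> {..<n} \<subseteq> {..<p} \<times> {..<m}" for p :: nat using assms(1) by auto
  have unit: "\<phi> (ounit (toeplitz_opsys m)) = ounit (toeplitz_opsys n)"
    by (rule eq_matI) (use assms(1) in \<open>auto simp: toeplitz_opsys_simps ind dim\<close>)
  have "complete_quotient_map (toeplitz_opsys m) (toeplitz_opsys n) \<phi>"
  proof (rule complete_quotient_mapI[OF operator_system_toeplitz operator_system_toeplitz])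
    show "cp_map (toeplitz_opsys m) (toeplitz_opsys n) \<phi>"
      unfolding cp_map_def
    proof (intro conjI allI impI ballI)
      have "\<phi> (A + B) = \<phi> A + \<phi> B" if "A \<in> toeplitz_mats m" "B \<in> toeplitz_mats m" for A B
        by (rule eq_matI)
           (use that[THEN toeplitz_mats_carrier] assms(1) in \<open>auto simp: ind dim\<close>)
      moreover have "\<phi> (c \<cdot>\<^sub>m A) = c \<cdot>\<^sub>m \<phi> A" if "A \<in> toeplitz_mats m" for A c
        by (rule eq_matI)
           (use that[THEN toeplitz_mats_carrier] assms(1) in \<open>auto simp: ind dim\<close>)
      ultimately show "\<phi> \<in> LinearCombinations.module_hom class_ring (toeplitz_opsys m) (toeplitz_opsys n)"
        using closed by (simp add: LinearCombinations.module_hom_def toeplitz_opsys_simps)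
    next
      fix p A assume "A \<in> cone (toeplitz_opsys m) p"
      then have A: "A \<in> mats (toeplitz_mats m) p"
        and "psd_on ({..<p} \<times> {..<m}) (block_kernel A)"
        by (auto simp: mem_cone_toeplitz_opsys)
      \<comment> \<open>Truncating every block restricts the kernel to a principal section, so
        positivity is inherited.\<close>
      then have "psd_on ({..<p} \<times> {..<n}) (block_kernel A)"
        using psd_on_subset sub by blast
      then show "map_mat \<phi> A \<in> cone (toeplitz_opsys n) p"
        using mats[OF A] kernel[OF A] psd_on_cong[of "{..<p} \<times> {..<n}" "block_kernel (map_mat \<phi> A)"]
        by (simp add: mem_cone_toeplitz_opsys)
    qed
  next
    show "\<phi> ` carrier (toeplitz_opsys m) = carrier (toeplitz_opsys n)"
      unfolding toeplitz_opsys_simps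
    proof (intro equalityI subsetI)
      fix B assume "B \<in> toeplitz_mats n"
      then obtain \<tau> where B: "B \<in> carrier_mat n n"
          "\<And>i j. i < n \<Longrightarrow> j < n \<Longrightarrow> B $$ (i, j) = \<tau> (int i - int j)"
        by (rule toeplitz_matsE) blast
      \<comment> \<open>Surjectivity concerns vector spaces only, so whatever values the chosen
        symbol takes on the new diagonals will do.\<close>
      let ?A = "mat m m (\<lambda>(i, j). \<tau> (int i - int j))"
      have "B = \<phi> ?A"
        by (rule eq_matI) (use B assms(1) in \<open>auto simp: ind dim\<close>)
      moreover have "?A \<in> toeplitz_mats m" by (rule toeplitz_matsI[of _ _ \<tau>]) auto
      ultimately show "B \<in> \<phi> ` toeplitz_mats m" by blast
    qed (use closed in blast)
  next
    fix A assume "A \<in> carrier (toeplitz_opsys m)"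
    then have "A \<in> carrier_mat m m" by (simp add: toeplitz_opsys_simps toeplitz_mats_carrier)
    then show "\<phi> (star (toeplitz_opsys m) A) = star (toeplitz_opsys n) (\<phi> A)"
      by (intro eq_matI) (use assms(1) in \<open>auto simp: toeplitz_opsys_simps ind dim index_mat_adjoint\<close>)
  next
    show "\<phi> (ounit (toeplitz_opsys m)) = ounit (toeplitz_opsys n)" by (rule unit)
  next
    fix p :: nat and \<epsilon> :: real
    assume "0 < \<epsilon>"
    then show "scaled_unit (toeplitz_opsys m) \<epsilon> p \<in> cone (toeplitz_opsys m) p"
      using psd_on_scalar[of "{..<p} \<times> {..<m}" \<epsilon>] scaled_unit_toeplitz_opsys(1)[of m \<epsilon> p]
        scaled_unit_toeplitz_opsys(2)[of _ p m _ \<epsilon>]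
        psd_on_cong[of "{..<p} \<times> {..<m}" "block_kernel (scaled_unit (toeplitz_opsys m) \<epsilon> p)"]
      by (simp add: mem_cone_toeplitz_opsys)
  next
    fix p B assume "B \<in> cone (toeplitz_opsys n) p"
    then have B: "B \<in> mats (toeplitz_mats n) p"
      and psd: "psd_on ({..<p} \<times> {..<n}) (block_kernel B)"
      by (auto simp: mem_cone_toeplitz_opsys)
    have "\<exists>\<sigma>. \<forall>i<n. \<forall>j<n. B $$ (a, b) $$ (i, j) = \<sigma> (int i - int j)" if "a < p" "b < p" for a b
      by (rule toeplitz_matsE[OF matsD(4)[OF B that]]) blast
    then obtain \<tau> where \<tau>: "\<And>a b i j. a < p \<Longrightarrow> b < p \<Longrightarrow> i < n \<Longrightarrow> j < n \<Longrightarrow>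
        B $$ (a, b) $$ (i, j) = \<tau> a b (int i - int j)"
      by metis
    have "psd_on ({..<p} \<times> {..<n}) (toeplitz_kernel \<tau>)"
      using psd psd_on_cong[of "{..<p} \<times> {..<n}" "block_kernel B" "toeplitz_kernel \<tau>"]
      by (auto simp: block_kernel_def toeplitz_kernel_def \<tau>)
    then obtain \<tau>' where psd': "psd_on ({..<p} \<times> {..<m}) (toeplitz_kernel \<tau>')"
      and \<tau>': "\<And>a b k. \<bar>k\<bar> < int n \<Longrightarrow> \<tau>' a b k = \<tau> a b k"
      using toeplitz_extend[of "{..<p}" n m \<tau>] assms by auto
    \<comment> \<open>Truncation recovers \<open>B\<close> because positions below \<open>n\<close>
      differ by less than \<open>n\<close> in absolute value, where \<open>\<tau>'\<close> agrees
      with \<open>\<tau>\<close>.\<close>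
    define A where "A = mat p p (\<lambda>(a, b). mat m m (\<lambda>(i, j). \<tau>' a b (int i - int j)))"
    have "A \<in> mats (toeplitz_mats m) p"
      by (auto simp: A_def mats_def intro: toeplitz_matsI)
    moreover have "block_kernel A x y = toeplitz_kernel \<tau>' x y"
      if "x \<in> {..<p} \<times> {..<m}" "y \<in> {..<p} \<times> {..<m}" for x y
      using that by (auto simp: A_def block_kernel_def toeplitz_kernel_def)
    ultimately have "A \<in> cone (toeplitz_opsys m) p"
      using psd' psd_on_cong[of "{..<p} \<times> {..<m}" "block_kernel A" "toeplitz_kernel \<tau>'"]
      by (simp add: mem_cone_toeplitz_opsys)
    moreover have "map_mat \<phi> A = B"
    proof (rule eq_matI)
      fix a b assume "a < dim_row B" "b < dim_col B"
      then have ab: "a < p" "b < p" using matsD[OF B] by auto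
      have "\<phi> (A $$ (a, b)) = B $$ (a, b)"
      proof (rule eq_matI)
        fix i j assume "i < dim_row (B $$ (a, b))" "j < dim_col (B $$ (a, b))"
        then have ij: "i < n" "j < n" using toeplitz_mats_carrier[OF matsD(4)[OF B ab]] by auto
        then show "\<phi> (A $$ (a, b)) $$ (i, j) = B $$ (a, b) $$ (i, j)"
          using ab assms(1) by (simp add: ind A_def \<tau> \<tau>')
      qed (use toeplitz_mats_carrier[OF matsD(4)[OF B ab]] in \<open>auto simp: dim\<close>)
      then show "map_mat \<phi> A $$ (a, b) = B $$ (a, b)" using ab by (simp add: A_def)
    qed (use matsD[OF B] in \<open>auto simp: A_def\<close>)
    ultimately show "\<exists>A\<in>cone (toeplitz_opsys m) p. map_mat \<phi> A = B" by blast
  qed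
  then show ?thesis
    unfolding is_operator_system_quotient_of_def using unit by blast
qed

end
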